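(* Let $X$ be a compact metrizable space and let $\Delta$ be a closed set of Borel probability measures on $X$. (i) If $(X,\Delta)$ has the small boundary property, then for every $f\in \mathrm{C}_{\mathbb R}(X)$ the class of the constant sequence $(f,f,\dots)$ can be approximated arbitrarily well in the C*-norm of $\ell^\infty(\mathrm{C}(X))/J_{2,\omega,\Delta}$ by self-adjoint invertible elements of $\overline{\mathrm{C}(X)}^{\Delta}$. (ii) Conversely, if for every $f\in \mathrm{C}_{\mathbb R}(X)$ the class of the constant sequence $(f,f,\dots)$ can be approximated arbitrarily well in $\|\cdot\|_{2,\omega,\Delta}$ by self-adjoint invertible elements of $\overline{\mathrm{C}(X)}^{\Delta}$, then $(X,\Delta)$ has the small boundary property.
   Context: Measures act as traces $\tau_\mu(f)=\int f\,d\mu$; "closed" is in the weak* topology. $\mathrm{C}_{\mathbb R}(X)$ denotes real-valued continuous functions. $\omega$ is a free ultrafilter on $\mathbb N$; $J_{2,\omega,\Delta}=\{(f_n)\in\ell^\infty(\mathrm{C}(X)):\lim_{n\to\omega}\sup_{\tau\in\Delta}\tau(|f_n|^2)=0\}$; $\|(a_n)\|_{2,\omega,\Delta}=\lim_{n\to\omega}\sup_{\tau\in\Delta}\tau(|a_n|^2)$, which induces a function on the quotient $\ell^\infty(\mathrm{C}(X))/J_{2,\omega,\Delta}$. For $f\in\mathrm{C}(X)$, $\|f\|_{2,\Delta}=\sup_{\mu\in\Delta}(\int|f|^2d\mu)^{1/2}$. $\overline{\mathrm{C}(X)}^{\Delta}$ is the sub-C*-algebra of $\ell^\infty(\mathrm{C}(X))/J_{2,\omega,\Delta}$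 consisting of classes of bounded sequences in $\mathrm{C}(X)$ that are Cauchy for $\|\cdot\|_{2,\Delta}$. $(X,\Delta)$ has the small boundary property if for every $x\in X$ and open $U\ni x$ there is an open neighbourhood $V\subseteq U$ of $x$ with $\mu(\partial V)=0$ for all $\mu\in\Delta$. *)

theory Defs
  imports "HOL-Probability.Probability"
begin

definition borel_prob :: "'a::topological_space measure \<Rightarrow> bool" where
  "borel_prob \<mu> \<longleftrightarrow> prob_space \<mu> \<and> sets \<mu> = sets borel"

definition weakstar_closed :: "'a::topological_space measure set \<Rightarrow> bool" where
  "weakstar_closed \<Delta> \<longleftrightarrow>
     (\<forall>\<mu>. borel_prob \<mu> \<and> \<mu> \<notin> \<Delta> \<longrightarrow>
        (\<exists>F :: ('a \<Rightarrow> real) set. finite F \<and> (\<forall>f\<in>F. continuous_on UNIV f) \<and>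
          (\<exists>\<epsilon>>0. \<forall>\<nu>\<in>\<Delta>. \<exists>f\<in>F.
              \<bar>integral\<^sup>L \<nu> f - integral\<^sup>L \<mu> f\<bar> \<ge> \<epsilon>)))"

definition small_boundary_property :: "'a::topological_space measure set \<Rightarrow> bool" where
  "small_boundary_property \<Delta> \<longleftrightarrow>
     (\<forall>x U. open U \<and> x \<in> U \<longrightarrow>
        (\<exists>V. open V \<and> x \<in> V \<and> V \<subseteq> U \<and> (\<forall>\<mu>\<in>\<Delta>. emeasure \<mu> (frontier V) = 0)))"

definition free_ultrafilter :: "nat filter \<Rightarrow> bool" where
  "free_ultrafilter \<omega> \<longleftrightarrow> \<omega> \<noteq> bot \<and>
     (\<forall>A. eventually (\<lambda>n. n \<in> A) \<omega> \<or> eventually (\<lambda>n. n \<notin> A) \<omega>) \<and>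
     (\<forall>A. finite A \<longrightarrow> eventually (\<lambda>n. n \<notin> A) \<omega>)"

definition linf_seq :: "(nat \<Rightarrow> 'a::topological_space \<Rightarrow> complex) \<Rightarrow> bool" where
  "linf_seq a \<longleftrightarrow> (\<forall>n. continuous_on UNIV (a n)) \<and> (\<exists>B. \<forall>n x. cmod (a n x) \<le> B)"

text \<open>sup over tau in Delta of tau(|f|^2); the supremum over the empty set is taken to be 0.\<close>
definition sup_tr2 :: "'a::topological_space measure set \<Rightarrow> ('a \<Rightarrow> complex) \<Rightarrow> real" where
  "sup_tr2 \<Delta> f = Sup (insert 0 {integral\<^sup>L \<mu> (\<lambda>x. (cmod (f x))\<^sup>2) | \<mu>. \<mu> \<in> \<Delta>})"

definition norm2D :: "'a::topological_space measure set \<Rightarrow> ('a \<Rightarrow> complex) \<Rightarrow> real" where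
  "norm2D \<Delta> f = Sup (insert 0 {sqrt (integral\<^sup>L \<mu> (\<lambda>x. (cmod (f x))\<^sup>2)) | \<mu>. \<mu> \<in> \<Delta>})"

definition J2 :: "nat filter \<Rightarrow> 'a::topological_space measure set \<Rightarrow> (nat \<Rightarrow> 'a \<Rightarrow> complex) set" where
  "J2 \<omega> \<Delta> = {a. linf_seq a \<and> ((\<lambda>n. sup_tr2 \<Delta> (a n)) \<longlongrightarrow> 0) \<omega>}"

text \<open>\<parallel>(a_n)\<parallel>_{2,omega,Delta} = lim_{n->omega} sup_{tau in Delta} tau(|a_n|^2)
  (well defined on classes modulo J2).\<close>
definition norm2w :: "nat filter \<Rightarrow> 'a::topological_space measure set \<Rightarrow> (nat \<Rightarrow> 'a \<Rightarrow> complex) \<Rightarrow> real" where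
  "norm2w \<omega> \<Delta> a = Lim \<omega> (\<lambda>n. sup_tr2 \<Delta> (a n))"

definition supnorm :: "(nat \<Rightarrow> 'a \<Rightarrow> complex) \<Rightarrow> real" where
  "supnorm a = Sup {cmod (a n x) | n x. True}"

definition qnorm :: "nat filter \<Rightarrow> 'a::topological_space measure set \<Rightarrow> (nat \<Rightarrow> 'a \<Rightarrow> complex) \<Rightarrow> real" where
  "qnorm \<omega> \<Delta> a = Inf {supnorm (\<lambda>n x. a n x + j n x) | j. j \<in> J2 \<omega> \<Delta>}"

text \<open>Representatives of elements of the closure algebra: bounded sequences in C(X)
  that are Cauchy for norm2D.\<close>
definition cauchy_seqs :: "'a::topological_space measure set \<Rightarrow> (nat \<Rightarrow> 'a \<Rightarrow> complex) set" where
  "cauchy_seqs \<Delta> = {g. linf_seq g \<and>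
     (\<forall>\<epsilon>>0. \<exists>N. \<forall>m\<ge>N. \<forall>n\<ge>N. norm2D \<Delta> (\<lambda>x. g m x - g n x) < \<epsilon>)}"

definition selfadj_cls :: "nat filter \<Rightarrow> 'a::topological_space measure set \<Rightarrow> (nat \<Rightarrow> 'a \<Rightarrow> complex) \<Rightarrow> bool" where
  "selfadj_cls \<omega> \<Delta> g \<longleftrightarrow> (\<lambda>n x. cnj (g n x) - g n x) \<in> J2 \<omega> \<Delta>"

text \<open>The class [g] is invertible in the closure algebra (which is commutative).\<close>
definition invertible_cls :: "nat filter \<Rightarrow> 'a::topological_space measure set \<Rightarrow> (nat \<Rightarrow> 'a \<Rightarrow> complex) \<Rightarrow> bool" where
  "invertible_cls \<omega> \<Delta> g \<longleftrightarrow> (\<exists>h\<in>cauchy_seqs \<Delta>. (\<lambda>n x. g n x * h n x - 1) \<in> J2 \<omega> \<Delta>)"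

end

theory Submission
  imports Defs
begin

text \<open>
  (i) Choose an open \<open>V\<close> with \<open>{f = 0} \<subseteq> V \<subseteq> {\<bar>f\<bar> < c}\<close> whose boundary is null for every \<open>\<mu> \<in> \<Delta>\<close>, and
  let \<open>F\<close> be \<open>c\<close> on \<open>V\<close> and \<open>f\<close> elsewhere: it is within \<open>2 c\<close> of \<open>f\<close>, bounded away from \<open>0\<close>, and
  discontinuous only on the boundary of \<open>V\<close>. With bump functions \<open>\<phi> n\<close> decreasing to the indicator of
  the boundary, \<open>(1 - \<phi> n) * F\<close> represents the approximant and \<open>(1 - \<phi> n) / F\<close> its inverse. By Dini's
  theorem the integrals of \<open>\<phi> n\<close> tend to \<open>0\<close> uniformly on \<open>\<Delta>\<close>, because \<open>\<Delta>\<close> is weak* compact: a limit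
  along \<open>\<omega>\<close> of probability measures \<open>M n\<close> is generated by the content \<open>K \<mapsto> lim M n K\<close> on compact sets.

  (ii) An invertible self-adjoint element near \<open>f\<close> yields a continuous function uniformly near \<open>f\<close> that
  is bounded away from \<open>0\<close> off a set of uniformly small measure. Iterating, \<open>f\<close> is a uniform limit of
  continuous functions \<open>h\<close> whose zero sets are null for every \<open>\<mu> \<in> \<Delta>\<close>, and the boundary of \<open>{h > 0}\<close>
  is contained in the zero set of \<open>h\<close>.
\<close>

section \<open>Measures from contents\<close>

text \<open>Normality separates the disjoint closed sets \<open>K - U\<close> and
  \<open>K - V\<close> by open sets; removing one or the other from \<open>K\<close> leaves the two
  compact pieces. This is what makes the inner content below subadditive on open sets.\<close>

lemma compact_subset_Un_openE:
  fixes K :: "'a::t4_space set"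
  assumes "compact K" "open U" "open V" "K \<subseteq> U \<union> V"
  obtains L M where "compact L" "compact M" "L \<subseteq> U" "M \<subseteq> V" "K = L \<union> M"
proof -
  have "closed (K - U)" "closed (K - V)" "(K - U) \<inter> (K - V) = {}"
    using assms by (auto simp: compact_imp_closed closed_Diff)
  from t4_space[OF this] obtain S T
    where "open S" "open T" "K - U \<subseteq> S" "K - V \<subseteq> T" "S \<inter> T = {}"
    by auto
  then show thesis
    using assms by (intro that[of "K - S" "K - T"]) (auto simp: compact_diff)
qed

text \<open>The classical passage from a content to a Borel measure: extend to open sets from
  inside, to all sets from outside, and apply Caratheodory. Only the values on open sets are
  recorded, where the measure agrees with the inner extension.\<close>

lemma compact_content_extends_to_measure:
  fixes m :: "'a::t4_space set \<Rightarrow> ennreal"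
  assumes empty: "m {} = 0"
    and mono: "\<And>K L. compact K \<Longrightarrow> compact L \<Longrightarrow> K \<subseteq> L \<Longrightarrow> m K \<le> m L"
    and subadd: "\<And>K L. compact K \<Longrightarrow> compact L \<Longrightarrow> m (K \<union> L) \<le> m K + m L"
    and add: "\<And>K L. compact K \<Longrightarrow> compact L \<Longrightarrow> K \<inter> L = {} \<Longrightarrow> m (K \<union> L) = m K + m L"
  obtains \<mu> where "sets \<mu> = sets borel"
    "\<And>U. open U \<Longrightarrow> emeasure \<mu> U = (SUP K\<in>{K. compact K \<and> K \<subseteq> U}. m K)"
proof -
  \<comment> \<open>\<open>i\<close> is the inner content, meant for open sets; \<open>F\<close> is
    the outer measure it induces through open supersets.\<close>
  define i where "i U = (SUP K\<in>{K. compact K \<and> K \<subseteq> U}. m K)" for U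
  define F where "F A = (INF U\<in>{U. open U \<and> A \<subseteq> U}. i U)" for A
  have i_upper: "m K \<le> i U" if "compact K" "K \<subseteq> U" for K U
    unfolding i_def using that by (intro SUP_upper) auto
  have i_mono: "i U \<le> i V" if "U \<subseteq> V" for U V
    unfolding i_def using that by (intro SUP_subset_mono) auto
  have i_empty: "i {} = 0"
    unfolding i_def by (auto simp: empty)
  have i_Un: "i (U \<union> V) \<le> i U + i V" if op: "open U" "open V" for U V
    unfolding i_def[of "U \<union> V"]
  proof (rule SUP_least, clarify)
    fix K assume K: "compact K" "K \<subseteq> U \<union> V"
    obtain L M where LM: "compact L" "compact M" "L \<subseteq> U" "M \<subseteq> V" "K = L \<union> M"
      using compact_subset_Un_openE[OF K(1) op K(2)] .
    have "m K \<le> m L + m M" using LM subadd by simp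
    also have "\<dots> \<le> i U + i V" by (intro add_mono i_upper LM)
    finally show "m K \<le> i U + i V" .
  qed
  have i_UN: "i (\<Union>n\<in>I. U n) \<le> (\<Sum>n\<in>I. i (U n))" if "finite I" "\<And>n. n \<in> I \<Longrightarrow> open (U n)"
    for U and I :: "nat set"
    using that
  proof (induction I rule: finite_induct)
    case (insert n I)
    have "i (\<Union>n\<in>insert n I. U n) \<le> i (U n) + i (\<Union>n\<in>I. U n)"
      using i_Un[of "U n" "\<Union>n\<in>I. U n"] insert.prems by auto
    then show ?case
      using insert by (simp add: add_left_mono order_trans)
  qed (simp add: i_empty)
  have i_countable: "i (\<Union>n. U n) \<le> (\<Sum>n. i (U n))" if op: "\<And>n. open (U n)" for U :: "nat \<Rightarrow> 'a set"
    unfolding i_def[of "\<Union>n. U n"]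
  proof (rule SUP_least, clarify)
    fix K assume K: "compact K" "K \<subseteq> (\<Union>n. U n)"
    obtain I where I: "finite I" "K \<subseteq> (\<Union>n\<in>I. U n)"
      using op K(2) by (auto intro: compactE_image[OF K(1), of UNIV U])
    have "m K \<le> i (\<Union>n\<in>I. U n)" using K(1) I(2) by (rule i_upper)
    also have "\<dots> \<le> (\<Sum>n\<in>I. i (U n))" using i_UN[OF I(1), of U] op by auto
    also have "\<dots> \<le> (\<Sum>n. i (U n))" by (intro sum_le_suminf I) auto
    finally show "m K \<le> (\<Sum>n. i (U n))" .
  qed
  have F_open: "F U = i U" if "open U" for U
    unfolding F_def using that i_mono by (intro antisym INF_lower INF_greatest) auto
  have F_le: "F A \<le> i U" if "open U" "A \<subseteq> U" for A U
    unfolding F_def using that by (intro INF_lower) auto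
  have F_mono: "F A \<le> F B" if "A \<subseteq> B" for A B
    unfolding F_def using that by (intro INF_superset_mono) auto
  have F_countable: "F (\<Union>n. A n) \<le> (\<Sum>n. F (A n))" for A :: "nat \<Rightarrow> 'a set"
  proof (rule ennreal_le_epsilon)
    fix e :: real assume e: "0 < e" and fin: "(\<Sum>n. F (A n)) < top"
    \<comment> \<open>The usual allotment: the n-th cover may exceed \<open>F (A n)\<close> by
      \<open>e / 2^(n+1)\<close>, and these errors add up to \<open>e\<close>.\<close>
    have "\<exists>U. open U \<and> A n \<subseteq> U \<and> i U \<le> F (A n) + e * (1/2)^Suc n" for n
    proof -
      have "F (A n) < F (A n) + ennreal (e * (1/2)^Suc n)"
        using fin e by (auto simp add: less_top dest!: ennreal_suminf_lessD)
      then show ?thesis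
        unfolding F_def[of "A n"] INF_less_iff by (auto intro: less_imp_le)
    qed
    then obtain U where U: "\<And>n. open (U n)" "\<And>n. A n \<subseteq> U n"
      "\<And>n. i (U n) \<le> F (A n) + e * (1/2)^Suc n"
      by metis
    have "F (\<Union>n. A n) \<le> i (\<Union>n. U n)" using U by (intro F_le) auto
    also have "\<dots> \<le> (\<Sum>n. i (U n))" using i_countable[of U] U(1) by auto
    also have "\<dots> \<le> (\<Sum>n. F (A n) + e * (1/2) ^ Suc n)"
      using U by (intro suminf_le) auto
    also have "... = (\<Sum>n. F (A n)) + (\<Sum>n. ennreal e * ennreal ((1/2) ^ Suc n))"
      using \<open>0 < e\<close> by (subst suminf_add[symmetric])
        (auto simp del: ennreal_suminf_cmult simp add: ennreal_mult[symmetric])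
    also have "\<dots> = (\<Sum>n. F (A n)) + e"
      unfolding ennreal_suminf_cmult
      by (subst suminf_ennreal_eq[OF zero_le_power power_half_series]) auto
    finally show "F (\<Union>n. A n) \<le> (\<Sum>n. F (A n)) + e" .
  qed
  have outer: "outer_measure_space (Pow UNIV) F"
    unfolding outer_measure_space_def positive_def increasing_def countably_subadditive_def
    using F_mono F_countable F_open[of "{}"] i_empty by auto
  \<comment> \<open>The core of Caratheodory measurability for open sets. First fix a compact
    \<open>K\<close> inside \<open>E \<inter> U\<close>, then exhaust the open set
    \<open>E - K\<close>, which contains \<open>E - U\<close>, by compact sets \<open>L\<close>;
    \<open>K\<close> and \<open>L\<close> are disjoint, so additivity of \<open>m\<close> applies.
    Each \<open>force\<close> shows that the supremum ranges over a nonempty family.\<close>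
  have i_split: "i (E \<inter> U) + F (E - U) \<le> i E" if "open E" "open U" for E U
    unfolding i_def[of "E \<inter> U"]
  proof (subst ennreal_SUP_add_left[symmetric], force, rule SUP_least, clarify)
    fix K assume K: "compact K" "K \<subseteq> E \<inter> U"
    have "m K + F (E - U) \<le> m K + i (E - K)"
      using K that by (intro add_left_mono F_le open_Diff) (auto simp: compact_imp_closed)
    also have "\<dots> \<le> i E"
      unfolding i_def[of "E - K"]
    proof (subst ennreal_SUP_add_right, force, rule SUP_least, clarify)
      fix L assume L: "compact L" "L \<subseteq> E - K"
      have "m K + m L = m (K \<union> L)"
        using K L by (intro add[symmetric]) auto
      also have "\<dots> \<le> i E"
        using K L by (intro i_upper) auto
      finally show "m K + m L \<le> i E" .
    qed
    finally show "m K + F (E - U) \<le> i E" .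
  qed
  \<comment> \<open>The ambient sigma-algebra for Caratheodory's lemma is the full power set, on
    which \<open>F\<close> is defined.\<close>
  interpret sigma_algebra "UNIV :: 'a set" "Pow UNIV" by (rule sigma_algebra_Pow)
  have F_split: "F (A \<inter> U) + F (A - U) = F A" if "open U" for A U
  proof (rule antisym)
    show "F (A \<inter> U) + F (A - U) \<le> F A"
      unfolding F_def[of A]
    proof (rule INF_greatest, clarify)
      fix E assume E: "open E" "A \<subseteq> E"
      have "F (A \<inter> U) + F (A - U) \<le> F (E \<inter> U) + F (E - U)"
        using E by (intro add_mono F_mono) auto
      also have "\<dots> = i (E \<inter> U) + F (E - U)" using E that by (simp add: F_open open_Int)
      also have "\<dots> \<le> i E" using E that by (intro i_split)
      finally show "F (A \<inter> U) + F (A - U) \<le> i E" .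
    qed
    have "subadditive (Pow UNIV) F"
      using outer unfolding outer_measure_space_def
      by (intro countably_subadditive_subadditive) auto
    from this[unfolded subadditive_def, rule_format, of "A \<inter> U" "A - U"]
    show "F A \<le> F (A \<inter> U) + F (A - U)" by (simp add: Int_Diff_Un Int_Diff_disjoint)
  qed
  have ms: "measure_space UNIV (lambda_system UNIV (Pow UNIV) F) F"
    using caratheodory_lemma[OF outer] by simp
  then have sa: "sigma_algebra UNIV (lambda_system UNIV (Pow UNIV) F)"
    by (simp add: measure_space_def)
  \<comment> \<open>The measurable sets of \<open>F\<close> form a sigma-algebra containing the open
    sets, hence all Borel sets, so \<open>F\<close> can be restricted to them.\<close>
  have "Collect open \<subseteq> lambda_system UNIV (Pow UNIV) F"
    unfolding lambda_system_eq using F_split by auto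
  then have "sets borel \<subseteq> lambda_system UNIV (Pow UNIV) F"
    using sigma_algebra.sigma_sets_subset[OF sa] by (simp add: borel_def)
  then have "measure_space UNIV (sets borel) F"
    using ms sets.sigma_algebra_axioms[of "borel :: 'a measure"] by (intro measure_down[OF ms]) auto
  then have "emeasure (measure_of UNIV (sets borel) F) A = F A" if "A \<in> sets borel" for A
    using that sets.sigma_algebra_axioms[of "borel :: 'a measure"]
    by (intro emeasure_measure_of_sigma) (auto simp: measure_space_def)
  then show thesis
    using F_open by (intro that[of "measure_of UNIV (sets borel) F"])
      (auto simp: i_def sets.sigma_sets_eq[of borel, simplified])
qed

section \<open>Weak* compactness of probability measures\<close>

text \<open>Compactness gives a cluster point along \<open>\<omega>\<close>. For an ultrafilter a
  cluster point is a limit: if the preimage of a neighbourhood were not in \<open>\<omega>\<close>,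
  its complement would be, contradicting clustering.\<close>

lemma ultrafilter_tendsto_compactE:
  fixes x :: "nat \<Rightarrow> 'b::topological_space"
  assumes "free_ultrafilter \<omega>" "compact K" "\<And>n. x n \<in> K"
  obtains l where "l \<in> K" "(x \<longlongrightarrow> l) \<omega>"
proof -
  have "\<omega> \<noteq> bot" and ultra: "\<And>A. eventually (\<lambda>n. n \<in> A) \<omega> \<or> eventually (\<lambda>n. n \<notin> A) \<omega>"
    using assms(1) by (auto simp: free_ultrafilter_def)
  have "filtermap x \<omega> \<noteq> bot" "eventually (\<lambda>y. y \<in> K) (filtermap x \<omega>)"
    using \<open>\<omega> \<noteq> bot\<close> assms(3) by (auto simp: filtermap_bot_iff eventually_filtermap)
  then obtain l where l: "l \<in> K" "inf (nhds l) (filtermap x \<omega>) \<noteq> bot"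
    using assms(2) unfolding compact_filter by blast
  have "(x \<longlongrightarrow> l) \<omega>"
  proof (rule topological_tendstoI)
    fix S assume S: "open S" "l \<in> S"
    show "eventually (\<lambda>n. x n \<in> S) \<omega>"
    proof (rule ccontr)
      assume "\<not> eventually (\<lambda>n. x n \<in> S) \<omega>"
      then have "eventually (\<lambda>n. x n \<notin> S) \<omega>" using ultra[of "{n. x n \<in> S}"] by auto
      then have "eventually (\<lambda>y. y \<notin> S) (filtermap x \<omega>)" by (simp add: eventually_filtermap)
      moreover have "eventually (\<lambda>y. y \<in> S) (nhds l)" using S by (rule eventually_nhds_in_open)
      ultimately have "eventually (\<lambda>_. False) (inf (nhds l) (filtermap x \<omega>))"
        unfolding eventually_inf by blast
      with l(2) show False by (simp add: eventually_False)
    qed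
  qed
  with l(1) show thesis by (rule that)
qed

text \<open>This is where freeness enters: ordinary limits of sequences are also limits along
  \<open>\<omega>\<close>.\<close>

lemma free_ultrafilter_le_sequentially:
  assumes "free_ultrafilter \<omega>"
  shows "\<omega> \<le> sequentially"
proof (rule filter_leI)
  fix P :: "nat \<Rightarrow> bool" assume "eventually P sequentially"
  then obtain N where "\<And>n. n \<ge> N \<Longrightarrow> P n" by (auto simp: eventually_sequentially)
  moreover have "eventually (\<lambda>n. n \<notin> {..<N}) \<omega>"
    using assms unfolding free_ultrafilter_def by blast
  ultimately show "eventually P \<omega>" by (auto elim: eventually_mono)
qed

section \<open>Integrability against Borel probability measures\<close>

lemma borel_prob_space [simp]: "borel_prob \<mu> \<Longrightarrow> space \<mu> = UNIV"
  using sets_eq_imp_space_eq[of \<mu> borel] by (simp add: borel_prob_def)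

lemma borel_prob_measurable:
  "borel_prob \<mu> \<Longrightarrow> f \<in> borel_measurable borel \<Longrightarrow> f \<in> borel_measurable \<mu>"
  by (simp add: borel_prob_def cong: measurable_cong_sets)

lemma borel_prob_integrable_bounded:
  fixes f :: "'a::topological_space \<Rightarrow> real"
  assumes "borel_prob \<mu>" "f \<in> borel_measurable borel" "\<And>x. \<bar>f x\<bar> \<le> B"
  shows "integrable \<mu> f"
proof -
  interpret prob_space \<mu> using assms by (simp add: borel_prob_def)
  show ?thesis
    using assms by (intro integrable_const_bound[of _ B]) (auto simp: borel_prob_measurable)
qed

lemma compact_UNIV_continuous_bounded:
  fixes f :: "'a::topological_space \<Rightarrow> real"
  assumes "compact (UNIV :: 'a set)" "continuous_on UNIV f"
  obtains B where "B > 0" "\<And>x. \<bar>f x\<bar> \<le> B"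
proof -
  have "bounded (range f)"
    using assms compact_continuous_image compact_imp_bounded by blast
  then show thesis
    using that unfolding bounded_pos by auto
qed

lemma borel_prob_integrable_continuous:
  fixes f :: "'a::topological_space \<Rightarrow> real"
  assumes "compact (UNIV :: 'a set)" "borel_prob \<mu>" "continuous_on UNIV f"
  shows "integrable \<mu> f"
proof -
  obtain B where "\<And>x. \<bar>f x\<bar> \<le> B"
    using compact_UNIV_continuous_bounded[OF assms(1,3)] by blast
  then show ?thesis
    using assms by (intro borel_prob_integrable_bounded borel_measurable_continuous_onI)
qed

section \<open>Layer sums\<close>

lemma sum_level_indicators:
  fixes y :: real
  assumes "0 \<le> y" "y \<le> 1" "N > 0"
  shows "(\<Sum>i<N. of_bool (real i / N < y)) = real (nat \<lceil>N * y\<rceil>)"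
proof -
  have "N * y \<le> N" using assms by (simp add: mult_left_le)
  then have "{..<N} \<inter> {i. real i / N < y} = {..<nat \<lceil>N * y\<rceil>}"
    using assms by (auto simp: divide_less_eq mult.commute less_ceiling_iff zless_nat_eq_int_zless ceiling_le_iff
        intro: less_le_trans)
  then show ?thesis
    by (simp add: of_bool_def sum.If_cases)
qed

text \<open>A discrete layer-cake formula: averaging the level indicators rounds \<open>f\<close> up
  to the grid of mesh \<open>1 / N\<close>. The level sets use strict inequalities so that they are
  open for continuous \<open>f\<close>, which is where a measure built from a content can be
  controlled.\<close>

lemma borel_prob_layer_sum:
  fixes f :: "'a::topological_space \<Rightarrow> real"
  assumes "borel_prob \<mu>" "f \<in> borel_measurable borel" "\<And>x. 0 \<le> f x" "\<And>x. f x \<le> 1" "N > 0"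
  shows "integral\<^sup>L \<mu> f \<le> (\<Sum>i<N. measure \<mu> {x. real i / N < f x}) / N"
    and "(\<Sum>i<N. measure \<mu> {x. real i / N < f x}) / N \<le> integral\<^sup>L \<mu> f + 1 / N"
proof -
  interpret prob_space \<mu> using assms by (simp add: borel_prob_def)
  let ?s = "\<lambda>x. (\<Sum>i<N. indicat_real {x. real i / N < f x} x) / N"
  have meas: "{x. real i / N < f x} \<in> sets \<mu>" for i
  proof -
    have "{x \<in> space borel. real i / N < f x} \<in> sets borel" using assms(2) by measurable
    then show ?thesis using assms(1) by (simp add: borel_prob_def)
  qed
  have s: "?s x = real (nat \<lceil>N * f x\<rceil>) / N" for x
    using sum_level_indicators[of "f x" N] assms by (simp add: indicator_def of_bool_def)
  have int_f: "integrable \<mu> f"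
    using assms by (intro borel_prob_integrable_bounded[of _ _ 1]) auto
  have int_s: "integrable \<mu> ?s"
    using meas by (auto intro!: integrable_divide_zero integrable_sum simp: less_top[symmetric])
  have eq: "integral\<^sup>L \<mu> ?s = (\<Sum>i<N. measure \<mu> {x. real i / N < f x}) / N"
    using meas assms(1) by (simp add: Bochner_Integration.integral_sum less_top[symmetric])
  have "f x \<le> ?s x" for x
    unfolding s using assms(3,4)[of x] assms(5) by (simp add: field_simps)
  then show "integral\<^sup>L \<mu> f \<le> (\<Sum>i<N. measure \<mu> {x. real i / N < f x}) / N"
    unfolding eq[symmetric] by (intro integral_mono int_f int_s)
  have "?s x \<le> f x + 1 / N" for x
    unfolding s using assms(3,4)[of x] assms(5) by (simp add: field_simps) linarith
  then have "integral\<^sup>L \<mu> ?s \<le> integral\<^sup>L \<mu> (\<lambda>x. f x + 1 / N)"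
    by (intro integral_mono int_s Bochner_Integration.integrable_add int_f) auto
  then show "(\<Sum>i<N. measure \<mu> {x. real i / N < f x}) / N \<le> integral\<^sup>L \<mu> f + 1 / N"
    unfolding eq using int_f prob_space by simp
qed

text \<open>The limit along \<open>\<omega>\<close> of the set functions \<open>M n\<close> is
  finitely additive on Borel sets; on compact sets it is a content and generates
  \<open>\<mu>\<close>. On open sets \<open>\<mu>\<close> lies below the limit, which bounds
  integrals from above through layer sums; applying the bound to a function and to its complement to
  1 gives equality.\<close>

lemma borel_prob_weakstar_compact:
  fixes M :: "nat \<Rightarrow> 'a::t4_space measure"
  assumes compact: "compact (UNIV :: 'a set)" and \<omega>: "free_ultrafilter \<omega>"
    and M: "\<And>n. borel_prob (M n)"
  shows "\<exists>\<mu>. borel_prob \<mu> \<and>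
    (\<forall>f :: 'a \<Rightarrow> real. continuous_on UNIV f \<longrightarrow> ((\<lambda>n. integral\<^sup>L (M n) f) \<longlongrightarrow> integral\<^sup>L \<mu> f) \<omega>)"
proof -
  have nb: "\<omega> \<noteq> bot" using \<omega> by (simp add: free_ultrafilter_def)
  \<comment> \<open>The limit exists for every set \<open>A\<close>, measurable or not, since the
    values always lie in \<open>{0..1}\<close>.\<close>
  have "\<exists>l. ((\<lambda>n. measure (M n) A) \<longlongrightarrow> l) \<omega>" for A
  proof -
    have "measure (M n) A \<in> {0..1}" for n
      using M[of n] by (auto simp: borel_prob_def prob_space.prob_le_1)
    then show ?thesis
      using ultrafilter_tendsto_compactE[OF \<omega> compact_Icc, where x = "\<lambda>n. measure (M n) A"] by metis
  qed
  then obtain m where m: "\<And>A. ((\<lambda>n. measure (M n) A) \<longlongrightarrow> m A) \<omega>"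
    by metis
  have fin: "finite_measure (M n)" and sets_M: "sets (M n) = sets borel" for n
    using M[of n] by (auto simp: borel_prob_def prob_space_def)
  have borel_compact: "K \<in> sets borel" if "compact K" for K :: "'a set"
    using that by (simp add: borel_compact)
  have m_mono: "m A \<le> m B" if "A \<subseteq> B" "B \<in> sets borel" for A B
    using that
    by (intro tendsto_le[OF nb m m] always_eventually allI finite_measure.finite_measure_mono[OF fin])
      (auto simp: sets_M)
  have m_nonneg: "0 \<le> m A" for A
    by (intro tendsto_lowerbound[OF m _ nb] always_eventually) auto
  have m_UNIV: "m UNIV = 1"
  proof -
    have "measure (M n) UNIV = 1" for n
      using M[of n] prob_space.prob_space[of "M n"] by (simp add: borel_prob_def[of "M n"])
    then show ?thesis using m[of UNIV] nb by (simp add: tendsto_const_iff)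
  qed
  have m_Un: "m (A \<union> B) = m A + m B" if "A \<in> sets borel" "B \<in> sets borel" "A \<inter> B = {}" for A B
    using that m[of "A \<union> B"] tendsto_add[OF m[of A] m[of B]] finite_measure.finite_measure_Union[OF fin]
    by (intro tendsto_unique[OF nb m]) (simp add: sets_M)
  have m_subadd: "m (A \<union> B) \<le> m A + m B" if "A \<in> sets borel" "B \<in> sets borel" for A B
    using that
    by (intro tendsto_le[OF nb tendsto_add[OF m m] m] always_eventually allI
        measure_Un_le) (auto simp: sets_M)
  obtain \<mu> where sets_\<mu>: "sets \<mu> = sets borel"
    and \<mu>: "\<And>U. open U \<Longrightarrow> emeasure \<mu> U = (SUP K\<in>{K. compact K \<and> K \<subseteq> U}. ennreal (m K))"
  proof (rule compact_content_extends_to_measure[of "\<lambda>K. ennreal (m K)"])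
    show "ennreal (m {}) = 0" using m[of "{}"] nb by (simp add: tendsto_const_iff)
  qed (use m_mono m_subadd m_Un m_nonneg borel_compact in \<open>auto simp flip: ennreal_plus intro!: ennreal_leI\<close>)
  \<comment> \<open>No mass escapes: \<open>UNIV\<close> is itself compact and competes in the
    supremum.\<close>
  have "emeasure \<mu> UNIV = 1"
    unfolding \<mu>[OF open_UNIV]
    using compact m_UNIV m_mono[OF subset_UNIV]
    by (intro antisym SUP_least SUP_upper2[of UNIV]) auto
  then have borel_\<mu>: "borel_prob \<mu>"
    using sets_eq_imp_space_eq[OF sets_\<mu>] sets_\<mu>
    by (auto simp: borel_prob_def intro!: prob_spaceI)
  \<comment> \<open>Only this inequality is available, since mass inside \<open>U\<close> may drift
    to its boundary in the limit.\<close>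
  have \<mu>_le: "measure \<mu> U \<le> m U" if "open U" for U
  proof -
    have "emeasure \<mu> U \<le> ennreal (m U)"
      unfolding \<mu>[OF that] using that by (intro SUP_least ennreal_leI m_mono) auto
    then show ?thesis
      by (simp add: measure_def enn2real_leI m_nonneg)
  qed
  have upper: "integral\<^sup>L \<mu> f \<le> l"
    if f: "continuous_on UNIV f" "\<And>x. 0 \<le> f x" "\<And>x. f x \<le> 1"
      and l: "((\<lambda>n. integral\<^sup>L (M n) f) \<longlongrightarrow> l) \<omega>" for f :: "'a \<Rightarrow> real" and l
  proof (rule field_le_epsilon)
    fix e :: real assume "e > 0"
    obtain N :: nat where N: "N > 0" "1 / N < e"
      using \<open>e > 0\<close> ex_inverse_of_nat_less[of e] by (auto simp: inverse_eq_divide)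
    let ?U = "\<lambda>i. {x. real i / N < f x}"
    have f_meas: "f \<in> borel_measurable borel"
      using f by (intro borel_measurable_continuous_onI)
    have "integral\<^sup>L \<mu> f \<le> (\<Sum>i<N. measure \<mu> (?U i)) / N"
      using borel_\<mu> f_meas f N by (intro borel_prob_layer_sum)
    also have "\<dots> \<le> (\<Sum>i<N. m (?U i)) / N"
      using f by (intro divide_right_mono sum_mono \<mu>_le open_Collect_less) auto
    \<comment> \<open>Here the layer sums of the \<open>M n\<close> are compared with their
      integrals, and the inequality is passed to the limit.\<close>
    also have "\<dots> \<le> l + 1 / N"
    proof (rule tendsto_le[OF nb tendsto_add[OF l tendsto_const] tendsto_divide[OF tendsto_sum[OF m] tendsto_const]])
      show "\<forall>\<^sub>F n in \<omega>. (\<Sum>i<N. measure (M n) (?U i)) / N \<le> integral\<^sup>L (M n) f + 1 / N"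
        using M f_meas f N by (intro always_eventually allI borel_prob_layer_sum)
    qed (use N in auto)
    also have "\<dots> \<le> l + e" using N by simp
    finally show "integral\<^sup>L \<mu> f \<le> l + e" .
  qed
  have "((\<lambda>n. integral\<^sup>L (M n) f) \<longlongrightarrow> integral\<^sup>L \<mu> f) \<omega>" if f: "continuous_on UNIV f"
    for f :: "'a \<Rightarrow> real"
  proof -
    obtain B where B: "B > 0" "\<And>x. \<bar>f x\<bar> \<le> B"
      using compact_UNIV_continuous_bounded[OF compact f] by blast
    \<comment> \<open>An affine rescaling of \<open>f\<close> into \<open>[0, 1]\<close>, so that
      \<open>upper\<close> applies both to \<open>g\<close> and to \<open>1 - g\<close>.\<close>
    define g where "g = (\<lambda>x. (f x + B) / (2 * B))"
    have g: "continuous_on UNIV g" "0 \<le> g x" "g x \<le> 1" for x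
      unfolding g_def using B(1) B(2)[of x] f by (auto intro!: continuous_intros simp: field_simps)
    have int_g: "integrable \<nu> g" if "borel_prob \<nu>" for \<nu>
      using compact that g(1) by (rule borel_prob_integrable_continuous)
    have int_f: "integral\<^sup>L \<nu> f = 2 * B * integral\<^sup>L \<nu> g - B"
      and int_1: "integral\<^sup>L \<nu> (\<lambda>x. 1 - g x) = 1 - integral\<^sup>L \<nu> g"
      if "borel_prob \<nu>" for \<nu>
    proof -
      interpret prob_space \<nu> using that by (simp add: borel_prob_def)
      have "integral\<^sup>L \<nu> f = integral\<^sup>L \<nu> (\<lambda>x. 2 * B * g x - B)"
        using B by (simp add: g_def)
      also have "\<dots> = 2 * B * integral\<^sup>L \<nu> g - B"
        using int_g[OF that] prob_space by (subst Bochner_Integration.integral_diff) auto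
      finally show "integral\<^sup>L \<nu> f = 2 * B * integral\<^sup>L \<nu> g - B" .
      show "integral\<^sup>L \<nu> (\<lambda>x. 1 - g x) = 1 - integral\<^sup>L \<nu> g"
        using int_g[OF that] prob_space by (subst Bochner_Integration.integral_diff) auto
    qed
    have "integral\<^sup>L (M n) g \<in> {0..1}" for n
    proof -
      interpret prob_space "M n" using M[of n] by (simp add: borel_prob_def)
      have "integral\<^sup>L (M n) g \<le> integral\<^sup>L (M n) (\<lambda>_. 1)"
        using g int_g[OF M] by (intro integral_mono) auto
      then show ?thesis using g prob_space by (auto intro: integral_nonneg)
    qed
    then obtain l where l: "((\<lambda>n. integral\<^sup>L (M n) g) \<longlongrightarrow> l) \<omega>"
      using ultrafilter_tendsto_compactE[OF \<omega> compact_Icc, where x = "\<lambda>n. integral\<^sup>L (M n) g"]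
      by metis
    have "integral\<^sup>L \<mu> g \<le> l" using g l by (rule upper)
    moreover have "integral\<^sup>L \<mu> (\<lambda>x. 1 - g x) \<le> 1 - l"
    proof (rule upper)
      show "((\<lambda>n. integral\<^sup>L (M n) (\<lambda>x. 1 - g x)) \<longlongrightarrow> 1 - l) \<omega>"
        unfolding int_1[OF M] by (intro tendsto_intros l)
    qed (use g in \<open>auto intro!: continuous_intros\<close>)
    ultimately have "l = integral\<^sup>L \<mu> g" using int_1[OF borel_\<mu>] by simp
    then show "((\<lambda>n. integral\<^sup>L (M n) f) \<longlongrightarrow> integral\<^sup>L \<mu> f) \<omega>"
      unfolding int_f[OF M] int_f[OF borel_\<mu>] using l by (intro tendsto_intros) simp
  qed
  with borel_\<mu> show ?thesis by blast
qed

text \<open>A measure outside \<open>\<Delta>\<close> is separated from it by finitely many test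
  functions, but finitely many convergent integrals are eventually all close at once.\<close>

lemma weakstar_closed_tendsto:
  assumes "weakstar_closed \<Delta>" "\<omega> \<noteq> bot" "\<And>n. M n \<in> \<Delta>" "borel_prob \<mu>"
    and lim: "\<And>f :: 'a::topological_space \<Rightarrow> real. continuous_on UNIV f \<Longrightarrow>
      ((\<lambda>n. integral\<^sup>L (M n) f) \<longlongrightarrow> integral\<^sup>L \<mu> f) \<omega>"
  shows "\<mu> \<in> \<Delta>"
proof (rule ccontr)
  assume "\<mu> \<notin> \<Delta>"
  with assms(1,4) obtain F :: "('a \<Rightarrow> real) set" and e
    where F: "finite F" "\<And>f. f \<in> F \<Longrightarrow> continuous_on UNIV f" and "e > 0"
      and far: "\<And>\<nu>. \<nu> \<in> \<Delta> \<Longrightarrow> \<exists>f\<in>F. \<bar>integral\<^sup>L \<nu> f - integral\<^sup>L \<mu> f\<bar> \<ge> e"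
    unfolding weakstar_closed_def by metis
  have "\<forall>\<^sub>F n in \<omega>. \<forall>f\<in>F. \<bar>integral\<^sup>L (M n) f - integral\<^sup>L \<mu> f\<bar> < e"
    using F tendstoD[OF lim \<open>e > 0\<close>] by (auto simp: eventually_ball_finite_distrib dist_real_def)
  then obtain n where "\<forall>f\<in>F. \<bar>integral\<^sup>L (M n) f - integral\<^sup>L \<mu> f\<bar> < e"
    using assms(2) eventually_happens' by blast
  with far[OF assms(3)[of n]] show False by force
qed

text \<open>If uniformity failed, some \<open>M n\<close> in \<open>\<Delta>\<close> would give
  \<open>\<phi> n\<close> integral at least \<open>e\<close>. By monotonicity
  \<open>\<phi> k\<close> has integral at least \<open>e\<close> for \<open>M n\<close> whenever
  \<open>n \<ge> k\<close>, and hence for the weak* limit, which lies in \<open>\<Delta>\<close>;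
  this contradicts pointwise convergence there.\<close>

lemma weakstar_Dini:
  fixes \<phi> :: "nat \<Rightarrow> 'a::t4_space \<Rightarrow> real"
  assumes compact: "compact (UNIV :: 'a set)" and \<omega>: "free_ultrafilter \<omega>"
    and \<Delta>: "\<And>\<mu>. \<mu> \<in> \<Delta> \<Longrightarrow> borel_prob \<mu>" "weakstar_closed \<Delta>"
    and \<phi>: "\<And>n. continuous_on UNIV (\<phi> n)" "\<And>m n x. m \<le> n \<Longrightarrow> \<phi> n x \<le> \<phi> m x"
    and lim: "\<And>\<mu>. \<mu> \<in> \<Delta> \<Longrightarrow> (\<lambda>n. integral\<^sup>L \<mu> (\<phi> n)) \<longlonglongrightarrow> 0"
    and "e > 0"
  shows "\<exists>N. \<forall>n\<ge>N. \<forall>\<mu>\<in>\<Delta>. integral\<^sup>L \<mu> (\<phi> n) < e"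
proof -
  have anti: "integral\<^sup>L \<mu> (\<phi> n) \<le> integral\<^sup>L \<mu> (\<phi> m)" if "m \<le> n" "\<mu> \<in> \<Delta>" for m n \<mu>
    using that \<phi> compact \<Delta>(1) by (intro integral_mono borel_prob_integrable_continuous) auto
  have "\<exists>N. \<forall>\<mu>\<in>\<Delta>. integral\<^sup>L \<mu> (\<phi> N) < e"
  proof (rule ccontr)
    assume "\<not> ?thesis"
    then have "\<forall>n. \<exists>\<mu>\<in>\<Delta>. integral\<^sup>L \<mu> (\<phi> n) \<ge> e" by (auto simp: not_less)
    then obtain M where M: "\<And>n. M n \<in> \<Delta>" "\<And>n. integral\<^sup>L (M n) (\<phi> n) \<ge> e" by metis
    have borel_M: "borel_prob (M n)" for n using \<Delta>(1) M(1) .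
    obtain \<mu> where \<mu>: "borel_prob \<mu>" "\<And>f :: 'a \<Rightarrow> real. continuous_on UNIV f \<Longrightarrow>
        ((\<lambda>n. integral\<^sup>L (M n) f) \<longlongrightarrow> integral\<^sup>L \<mu> f) \<omega>"
      using borel_prob_weakstar_compact[OF compact \<omega>, of M] borel_M by auto
    have nb: "\<omega> \<noteq> bot" using \<omega> by (simp add: free_ultrafilter_def)
    have "\<mu> \<in> \<Delta>" using weakstar_closed_tendsto[OF \<Delta>(2) nb M(1) \<mu>] .
    have "e \<le> integral\<^sup>L \<mu> (\<phi> k)" for k
    proof (rule tendsto_lowerbound[OF \<mu>(2)[OF \<phi>(1)] _ nb])
      have "\<forall>\<^sub>F n in \<omega>. n \<ge> k"
        using free_ultrafilter_le_sequentially[OF \<omega>] eventually_ge_at_top by (rule filter_leD)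
      then show "\<forall>\<^sub>F n in \<omega>. e \<le> integral\<^sup>L (M n) (\<phi> k)"
        by eventually_elim (metis M anti order_trans)
    qed
    then have "e \<le> 0" using lim[OF \<open>\<mu> \<in> \<Delta>\<close>] by (intro LIMSEQ_le_const) auto
    with \<open>e > 0\<close> show False by simp
  qed
  then show ?thesis using anti by (meson order_le_less_trans)
qed

section \<open>Trace seminorms\<close>

lemma continuous_integrable_cmod_power2:
  fixes f :: "'a::topological_space \<Rightarrow> complex"
  assumes "borel_prob \<mu>" "continuous_on UNIV f" "\<And>x. cmod (f x) \<le> B"
  shows "integrable \<mu> (\<lambda>x. (cmod (f x))\<^sup>2)"
  using assms
  by (intro borel_prob_integrable_bounded[of _ _ "B\<^sup>2"] borel_measurable_continuous_onI continuous_intros)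
    (auto intro: power_mono)

lemma integral_cmod_power2_le:
  fixes f :: "'a::topological_space \<Rightarrow> complex"
  assumes "borel_prob \<mu>" "continuous_on UNIV f" "\<And>x. cmod (f x) \<le> B"
  shows "(\<integral>x. (cmod (f x))\<^sup>2 \<partial>\<mu>) \<le> B\<^sup>2"
proof -
  interpret prob_space \<mu> using assms by (simp add: borel_prob_def)
  show ?thesis
    using assms by (intro integral_le_const continuous_integrable_cmod_power2) (auto intro!: power_mono)
qed

text \<open>The bound \<open>c \<ge> 0\<close> takes care of the inserted 0, and so of empty
  \<open>\<Delta>\<close>.\<close>

lemma sup_tr2_le:
  assumes "c \<ge> 0" "\<And>\<mu>. \<mu> \<in> \<Delta> \<Longrightarrow> (\<integral>x. (cmod (f x))\<^sup>2 \<partial>\<mu>) \<le> c"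
  shows "sup_tr2 \<Delta> f \<le> c"
  unfolding sup_tr2_def using assms by (intro cSup_least) auto

lemma norm2D_le:
  assumes "c \<ge> 0" "\<And>\<mu>. \<mu> \<in> \<Delta> \<Longrightarrow> (\<integral>x. (cmod (f x))\<^sup>2 \<partial>\<mu>) \<le> c\<^sup>2"
  shows "norm2D \<Delta> f \<le> c"
  unfolding norm2D_def using assms by (intro cSup_least) (auto intro: real_le_lsqrt)

lemma sup_tr2_bounded:
  fixes f :: "'a::topological_space \<Rightarrow> complex"
  assumes "\<And>\<mu>. \<mu> \<in> \<Delta> \<Longrightarrow> borel_prob \<mu>" "continuous_on UNIV f" "\<And>x. cmod (f x) \<le> B"
  shows "0 \<le> sup_tr2 \<Delta> f" "sup_tr2 \<Delta> f \<le> B\<^sup>2"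
    and "\<mu> \<in> \<Delta> \<Longrightarrow> (\<integral>x. (cmod (f x))\<^sup>2 \<partial>\<mu>) \<le> sup_tr2 \<Delta> f"
proof -
  have le: "(\<integral>x. (cmod (f x))\<^sup>2 \<partial>\<mu>) \<le> B\<^sup>2" if "\<mu> \<in> \<Delta>" for \<mu>
    using assms that by (intro integral_cmod_power2_le)
  have bdd: "bdd_above (insert 0 {integral\<^sup>L \<mu> (\<lambda>x. (cmod (f x))\<^sup>2) | \<mu>. \<mu> \<in> \<Delta>})"
    using le by (auto intro!: bdd_aboveI[of _ "B\<^sup>2"])
  show "0 \<le> sup_tr2 \<Delta> f" "\<mu> \<in> \<Delta> \<Longrightarrow> (\<integral>x. (cmod (f x))\<^sup>2 \<partial>\<mu>) \<le> sup_tr2 \<Delta> f"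
    unfolding sup_tr2_def by (rule cSup_upper[OF _ bdd]; blast)+
  show "sup_tr2 \<Delta> f \<le> B\<^sup>2" using le by (intro sup_tr2_le) auto
qed

section \<open>Bounded sequences and norms of their classes\<close>

lemma linf_seqI:
  assumes "\<And>n. continuous_on UNIV (a n)" "\<And>n x. cmod (a n x) \<le> B"
  shows "linf_seq a"
  using assms unfolding linf_seq_def by blast

lemma linf_seq_add: "linf_seq a \<Longrightarrow> linf_seq b \<Longrightarrow> linf_seq (\<lambda>n x. a n x + b n x)"
  unfolding linf_seq_def
  by (auto intro!: continuous_intros) (meson add_mono norm_triangle_le)

lemma linf_seq_mult: "linf_seq a \<Longrightarrow> linf_seq b \<Longrightarrow> linf_seq (\<lambda>n x. a n x * b n x)"
  unfolding linf_seq_def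
  by (auto intro!: continuous_intros simp: norm_mult) (meson mult_mono norm_ge_zero order_trans)

lemma linf_seq_const:
  fixes f :: "'a::topological_space \<Rightarrow> complex"
  assumes "compact (UNIV :: 'a set)" "continuous_on UNIV f"
  shows "linf_seq (\<lambda>_. f)"
proof -
  obtain B where "\<And>x. \<bar>cmod (f x)\<bar> \<le> B"
    using compact_UNIV_continuous_bounded[OF assms(1), of "\<lambda>x. cmod (f x)"] assms(2)
    by (auto intro: continuous_on_norm)
  then show ?thesis using assms by (intro linf_seqI[of _ B]) auto
qed

text \<open>A single correction \<open>j\<close> bounds the infimum. The real \<open>Inf\<close>
  requires a lower bound for this, hence the check that every \<open>supnorm\<close> involved is
  nonnegative.\<close>

lemma qnorm_le:
  fixes a :: "nat \<Rightarrow> 'a::topological_space \<Rightarrow> complex"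
  assumes "linf_seq a" "j \<in> J2 \<omega> \<Delta>" "\<And>n x. cmod (a n x + j n x) \<le> c"
  shows "qnorm \<omega> \<Delta> a \<le> c"
proof -
  have "0 \<le> supnorm (\<lambda>n x. a n x + k n x)" if "k \<in> J2 \<omega> \<Delta>" for k
  proof -
    have "linf_seq (\<lambda>n x. a n x + k n x)"
      using assms(1) that by (auto simp: J2_def intro: linf_seq_add)
    then obtain B where B: "\<And>n x. cmod (a n x + k n x) \<le> B"
      unfolding linf_seq_def by blast
    show ?thesis
      unfolding supnorm_def
    proof (rule cSup_upper2)
      show "cmod (a 0 undefined + k 0 undefined) \<in> {cmod (a n x + k n x) | n x. True}" by blast
    qed (use B in \<open>auto intro!: bdd_aboveI[of _ B]\<close>)
  qed
  then have "qnorm \<omega> \<Delta> a \<le> supnorm (\<lambda>n x. a n x + j n x)"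
    unfolding qnorm_def using assms(2) by (intro cInf_lower) (auto intro!: bdd_belowI[of _ 0])
  also have "\<dots> \<le> c"
    unfolding supnorm_def using assms(3) by (intro cSup_least) auto
  finally show ?thesis .
qed

text \<open>\<open>Lim\<close> says something only if a limit exists; it does because the values
  stay in a compact interval and \<open>\<omega>\<close> is an ultrafilter.\<close>

lemma norm2w_less_imp_eventually:
  assumes \<omega>: "free_ultrafilter \<omega>" and \<Delta>: "\<And>\<mu>. \<mu> \<in> \<Delta> \<Longrightarrow> borel_prob \<mu>"
    and a: "linf_seq a" "norm2w \<omega> \<Delta> a < e"
  shows "\<forall>\<^sub>F n in \<omega>. sup_tr2 \<Delta> (a n) < e"
proof -
  obtain B where "\<And>n x. cmod (a n x) \<le> B" "\<And>n. continuous_on UNIV (a n)"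
    using a(1) unfolding linf_seq_def by blast
  then have "sup_tr2 \<Delta> (a n) \<in> {0..B\<^sup>2}" for n
    using sup_tr2_bounded[of \<Delta> "a n" B] \<Delta> by auto
  then obtain l where l: "((\<lambda>n. sup_tr2 \<Delta> (a n)) \<longlongrightarrow> l) \<omega>"
    using ultrafilter_tendsto_compactE[OF \<omega> compact_Icc, where x = "\<lambda>n. sup_tr2 \<Delta> (a n)"] by metis
  moreover have "\<omega> \<noteq> bot" using \<omega> by (simp add: free_ultrafilter_def)
  ultimately have "norm2w \<omega> \<Delta> a = l" unfolding norm2w_def by (intro tendsto_Lim)
  with l a(2) show ?thesis by (auto intro: order_tendstoD)
qed

section \<open>Approximation from small boundaries\<close>

definition uniformly_vanishing :: "'a::topological_space measure set \<Rightarrow> (nat \<Rightarrow> 'a \<Rightarrow> real) \<Rightarrow> bool" where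
  "uniformly_vanishing \<Delta> \<phi> \<longleftrightarrow> (\<forall>n. continuous_on UNIV (\<phi> n)) \<and> (\<forall>n x. 0 \<le> \<phi> n x \<and> \<phi> n x \<le> 1) \<and>
     (\<forall>m n x. m \<le> n \<longrightarrow> \<phi> n x \<le> \<phi> m x) \<and>
     (\<forall>e>0. \<exists>N. \<forall>n\<ge>N. \<forall>\<mu>\<in>\<Delta>. integral\<^sup>L \<mu> (\<phi> n) < e)"

text \<open>Truncated multiples of the distance give functions decreasing to the indicator of
  \<open>K\<close>. Dominated convergence sends each integral to 0, and \<open>weakstar_Dini\<close>
  makes this uniform over \<open>\<Delta>\<close>.\<close>

lemma null_closed_bump:
  fixes K :: "'a::metric_space set"
  assumes compact: "compact (UNIV :: 'a set)" and \<omega>: "free_ultrafilter \<omega>"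
    and \<Delta>: "\<And>\<mu>. \<mu> \<in> \<Delta> \<Longrightarrow> borel_prob \<mu>" "weakstar_closed \<Delta>"
    and K: "closed K" "\<And>\<mu>. \<mu> \<in> \<Delta> \<Longrightarrow> emeasure \<mu> K = 0"
  obtains \<phi> where "uniformly_vanishing \<Delta> \<phi>" "\<And>n x. x \<in> K \<Longrightarrow> \<phi> n x = 1"
\<comment> \<open>The empty set is treated apart because \<open>infdist x {}\<close> is 0, which
  would make every \<open>\<phi> n\<close> constantly 1.\<close>
proof (cases "K = {}")
  case True
  then show thesis by (intro that[of "\<lambda>_ _. 0"]) (auto simp: uniformly_vanishing_def)
next
  case False
  define \<phi> where "\<phi> n x = max 0 (1 - real n * infdist x K)" for n and x :: 'a
  have cont: "continuous_on UNIV (\<phi> n)" for n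
    unfolding \<phi>_def by (intro continuous_intros)
  have range: "0 \<le> \<phi> n x" "\<phi> n x \<le> 1" for n x
    by (auto simp: \<phi>_def infdist_nonneg)
  have anti: "\<phi> n x \<le> \<phi> m x" if "m \<le> n" for m n x
    using that mult_right_mono[of "real m" "real n" "infdist x K"]
    by (auto simp: \<phi>_def infdist_nonneg)
  have lim_pt: "(\<lambda>n. \<phi> n x) \<longlonglongrightarrow> indicat_real K x" for x
  proof (cases "x \<in> K")
    case False
    then have "infdist x K > 0"
      using K(1) \<open>K \<noteq> {}\<close> by (simp add: infdist_pos_not_in_closed)
    then obtain N :: nat where "1 < real N * infdist x K" using ex_less_of_nat_mult by blast
    then have "\<phi> n x = 0" if "n \<ge> N" for n
      using anti[OF that, of x] range(1)[of n x] by (simp add: \<phi>_def)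
    then have "\<forall>\<^sub>F n in sequentially. \<phi> n x = 0" by (auto simp: eventually_sequentially)
    with False show ?thesis by (simp add: tendsto_eventually)
  qed (simp add: \<phi>_def)
  have "(\<lambda>n. integral\<^sup>L \<mu> (\<phi> n)) \<longlonglongrightarrow> 0" if "\<mu> \<in> \<Delta>" for \<mu>
  proof -
    have b: "borel_prob \<mu>" using \<Delta>(1) that .
    interpret prob_space \<mu> using b by (simp add: borel_prob_def)
    have "(\<lambda>n. integral\<^sup>L \<mu> (\<phi> n)) \<longlonglongrightarrow> integral\<^sup>L \<mu> (indicat_real K)"
    proof (rule integral_dominated_convergence[where w = "\<lambda>_. 1"])
      show "indicat_real K \<in> borel_measurable \<mu>"
        using K(1) by (intro borel_prob_measurable[OF b] borel_measurable_indicator) auto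
      show "\<phi> n \<in> borel_measurable \<mu>" for n
        using cont by (intro borel_prob_measurable[OF b] borel_measurable_continuous_onI)
    qed (use lim_pt range in auto)
    moreover have "integral\<^sup>L \<mu> (indicat_real K) = 0"
      using K(2)[OF that] b by (simp add: measure_def)
    ultimately show ?thesis by simp
  qed
  from weakstar_Dini[OF compact \<omega> \<Delta> cont anti this] have "uniformly_vanishing \<Delta> \<phi>"
    unfolding uniformly_vanishing_def using cont range anti by simp
  then show thesis by (rule that) (simp add: \<phi>_def)
qed

text \<open>Since \<open>\<phi> n\<close> takes values in \<open>[0, 1]\<close>, its square is at
  most itself.\<close>

lemma uniformly_vanishing_integral_le:
  fixes f :: "'a::topological_space \<Rightarrow> complex"
  assumes "uniformly_vanishing \<Delta> \<phi>" "borel_prob \<mu>" "continuous_on UNIV f"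
    and "\<And>x. cmod (f x) \<le> B * \<phi> n x"
  shows "(\<integral>x. (cmod (f x))\<^sup>2 \<partial>\<mu>) \<le> B\<^sup>2 * integral\<^sup>L \<mu> (\<phi> n)"
proof -
  have \<phi>: "continuous_on UNIV (\<phi> n)" "0 \<le> \<phi> n x" "\<phi> n x \<le> 1" for x
    using assms(1) by (auto simp: uniformly_vanishing_def)
  have int_\<phi>: "integrable \<mu> (\<phi> n)"
    using assms(2) \<phi> by (intro borel_prob_integrable_bounded[of _ _ 1] borel_measurable_continuous_onI) auto
  have le: "(cmod (f x))\<^sup>2 \<le> B\<^sup>2 * \<phi> n x" for x
  proof -
    have "(cmod (f x))\<^sup>2 \<le> (B * \<phi> n x)\<^sup>2" using assms(4) by (intro power_mono) auto
    also have "\<dots> = B\<^sup>2 * (\<phi> n x * \<phi> n x)" by (simp add: power2_eq_square)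
    also have "\<dots> \<le> B\<^sup>2 * \<phi> n x" using \<phi>(2,3)[of x] by (intro mult_left_mono) (auto simp: mult_left_le)
    finally show ?thesis .
  qed
  have "cmod (f x) \<le> \<bar>B\<bar>" for x
  proof -
    have "B * \<phi> n x \<le> \<bar>B\<bar> * 1" using \<phi>(2,3)[of x] by (intro mult_mono) auto
    then show ?thesis using assms(4)[of x] by simp
  qed
  then have "integrable \<mu> (\<lambda>x. (cmod (f x))\<^sup>2)"
    using assms by (intro continuous_integrable_cmod_power2) auto
  then have "(\<integral>x. (cmod (f x))\<^sup>2 \<partial>\<mu>) \<le> (\<integral>x. B\<^sup>2 * \<phi> n x \<partial>\<mu>)"
    using int_\<phi> le by (intro integral_mono) auto
  then show ?thesis by simp
qed

lemma uniformly_vanishing_integral_small: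
  assumes "uniformly_vanishing \<Delta> \<phi>" "e > 0"
  obtains N where "\<And>n \<mu>. n \<ge> N \<Longrightarrow> \<mu> \<in> \<Delta> \<Longrightarrow> B\<^sup>2 * integral\<^sup>L \<mu> (\<phi> n) < e"
proof -
  \<comment> \<open>The added 1 keeps the denominator positive when \<open>B = 0\<close>.\<close>
  have "e / (B\<^sup>2 + 1) > 0" using assms(2) by (simp add: add_nonneg_pos)
  moreover have "\<forall>e>0. \<exists>N. \<forall>n\<ge>N. \<forall>\<mu>\<in>\<Delta>. integral\<^sup>L \<mu> (\<phi> n) < e"
    using assms(1) by (simp add: uniformly_vanishing_def)
  ultimately have "\<exists>N. \<forall>n\<ge>N. \<forall>\<mu>\<in>\<Delta>. integral\<^sup>L \<mu> (\<phi> n) < e / (B\<^sup>2 + 1)"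
    by (elim allE impE)
  then obtain N where N: "\<And>n \<mu>. n \<ge> N \<Longrightarrow> \<mu> \<in> \<Delta> \<Longrightarrow> integral\<^sup>L \<mu> (\<phi> n) < e / (B\<^sup>2 + 1)"
    by auto
  have "B\<^sup>2 * integral\<^sup>L \<mu> (\<phi> n) < e" if "n \<ge> N" "\<mu> \<in> \<Delta>" for n \<mu>
  proof -
    have "0 \<le> integral\<^sup>L \<mu> (\<phi> n)"
      using assms(1) by (intro Bochner_Integration.integral_nonneg) (simp add: uniformly_vanishing_def)
    then have "B\<^sup>2 * integral\<^sup>L \<mu> (\<phi> n) \<le> (B\<^sup>2 + 1) * integral\<^sup>L \<mu> (\<phi> n)"
      by (intro mult_right_mono) auto
    also have "\<dots> < e"
      using N[OF that] by (simp add: pos_less_divide_eq add_nonneg_pos mult.commute)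
    finally show ?thesis .
  qed
  then show thesis by (rule that)
qed

text \<open>The main source of elements of \<open>J2\<close>: any sequence dominated by multiples of
  the bumps. Convergence is shown along the natural numbers and then transferred to
  \<open>\<omega>\<close>.\<close>

lemma uniformly_vanishing_imp_J2:
  fixes a :: "nat \<Rightarrow> 'a::topological_space \<Rightarrow> complex"
  assumes \<omega>: "free_ultrafilter \<omega>" and \<Delta>: "\<And>\<mu>. \<mu> \<in> \<Delta> \<Longrightarrow> borel_prob \<mu>"
    and \<phi>: "uniformly_vanishing \<Delta> \<phi>"
    and a: "\<And>n. continuous_on UNIV (a n)" "\<And>n x. cmod (a n x) \<le> B * \<phi> n x"
  shows "a \<in> J2 \<omega> \<Delta>"
proof -
  have bound: "cmod (a n x) \<le> \<bar>B\<bar>" for n x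
  proof -
    have "B * \<phi> n x \<le> \<bar>B\<bar> * 1" using \<phi> by (intro mult_mono) (auto simp: uniformly_vanishing_def)
    then show ?thesis using a(2)[of n x] by simp
  qed
  have nonneg: "0 \<le> sup_tr2 \<Delta> (a n)" for n
    using \<Delta> a(1) bound by (rule sup_tr2_bounded(1))
  have "(\<lambda>n. sup_tr2 \<Delta> (a n)) \<longlonglongrightarrow> 0"
  proof (rule LIMSEQ_I)
    fix e :: real assume "e > 0"
    then obtain N where N: "\<And>n \<mu>. n \<ge> N \<Longrightarrow> \<mu> \<in> \<Delta> \<Longrightarrow> B\<^sup>2 * integral\<^sup>L \<mu> (\<phi> n) < e / 2"
      using uniformly_vanishing_integral_small[OF \<phi>, of "e / 2" B] by auto
    have "sup_tr2 \<Delta> (a n) \<le> e / 2" if "n \<ge> N" for n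
    proof (rule sup_tr2_le)
      fix \<mu> assume "\<mu> \<in> \<Delta>"
      then show "(\<integral>x. (cmod (a n x))\<^sup>2 \<partial>\<mu>) \<le> e / 2"
        using N[OF that] uniformly_vanishing_integral_le[OF \<phi> \<Delta> a, of \<mu> n] by (meson less_imp_le order_trans)
    qed (use \<open>e > 0\<close> in simp)
    then show "\<exists>N. \<forall>n\<ge>N. norm (sup_tr2 \<Delta> (a n) - 0) < e"
      using nonneg \<open>e > 0\<close> by (intro exI[of _ N]) (auto intro: order_le_less_trans[of _ "e / 2"])
  qed
  then show ?thesis
    unfolding J2_def using free_ultrafilter_le_sequentially[OF \<omega>] a(1) bound
    by (auto intro: tendsto_mono linf_seqI)
qed

text \<open>\<open>F\<close> may be discontinuous as long as the bumps hide it. The difference of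
  two terms is \<open>(\<phi> n - \<phi> m) * F\<close>, and both bump values lie between 0 and
  \<open>\<phi> N\<close> once \<open>m\<close> and \<open>n\<close> are at least
  \<open>N\<close>.\<close>

lemma uniformly_vanishing_imp_cauchy_seqs:
  fixes F :: "'a::topological_space \<Rightarrow> real"
  assumes \<Delta>: "\<And>\<mu>. \<mu> \<in> \<Delta> \<Longrightarrow> borel_prob \<mu>" and \<phi>: "uniformly_vanishing \<Delta> \<phi>"
    and cont: "\<And>n. continuous_on UNIV (\<lambda>x. (1 - \<phi> n x) * F x)" and F: "\<And>x. \<bar>F x\<bar> \<le> B"
  shows "(\<lambda>n x. complex_of_real ((1 - \<phi> n x) * F x)) \<in> cauchy_seqs \<Delta>"
proof -
  let ?g = "\<lambda>n x. complex_of_real ((1 - \<phi> n x) * F x)"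
  have \<phi>': "0 \<le> \<phi> n x" "\<phi> n x \<le> 1" "m \<le> n \<Longrightarrow> \<phi> n x \<le> \<phi> m x" for m n x
    using \<phi> by (auto simp: uniformly_vanishing_def)
  have "linf_seq ?g"
  proof (rule linf_seqI)
    show "cmod (?g n x) \<le> B" for n x
      unfolding norm_of_real abs_mult
      using mult_mono[of "\<bar>1 - \<phi> n x\<bar>" 1 "\<bar>F x\<bar>" B] F[of x] \<phi>'(1,2)[of n x] by simp
    show "continuous_on UNIV (?g n)" for n
      using cont by (intro continuous_on_of_real)
  qed
  moreover have "\<exists>N. \<forall>m\<ge>N. \<forall>n\<ge>N. norm2D \<Delta> (\<lambda>x. ?g m x - ?g n x) < e" if "e > 0" for e
  proof -
    from \<open>e > 0\<close> have "(e / 2)\<^sup>2 > 0" by simp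
    then obtain N where N: "\<And>n \<mu>. n \<ge> N \<Longrightarrow> \<mu> \<in> \<Delta> \<Longrightarrow> B\<^sup>2 * integral\<^sup>L \<mu> (\<phi> n) < (e / 2)\<^sup>2"
      using uniformly_vanishing_integral_small[OF \<phi>, of "(e / 2)\<^sup>2" B] by auto
    have "norm2D \<Delta> (\<lambda>x. ?g m x - ?g n x) \<le> e / 2" if "m \<ge> N" "n \<ge> N" for m n
    proof (rule norm2D_le)
      fix \<mu> assume \<mu>: "\<mu> \<in> \<Delta>"
      have "(\<integral>x. (cmod (?g m x - ?g n x))\<^sup>2 \<partial>\<mu>) \<le> B\<^sup>2 * integral\<^sup>L \<mu> (\<phi> N)"
      proof (rule uniformly_vanishing_integral_le[OF \<phi> \<Delta>[OF \<mu>]])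
        show "continuous_on UNIV (\<lambda>x. ?g m x - ?g n x)"
          using cont by (intro continuous_on_diff continuous_on_of_real)
        fix x
        have "?g m x - ?g n x = of_real ((\<phi> n x - \<phi> m x) * F x)"
          by (simp add: algebra_simps flip: of_real_mult of_real_diff)
        moreover have "\<bar>\<phi> n x - \<phi> m x\<bar> \<le> \<phi> N x"
          using \<phi>'(1)[of n x] \<phi>'(1)[of m x] \<phi>'(3)[OF that(1), of x] \<phi>'(3)[OF that(2), of x] by auto
        then have "\<bar>(\<phi> n x - \<phi> m x) * F x\<bar> \<le> \<phi> N x * B"
          unfolding abs_mult using F[of x] by (intro mult_mono) auto
        ultimately show "cmod (?g m x - ?g n x) \<le> B * \<phi> N x"
          by (simp add: mult.commute del: of_real_mult of_real_diff)
      qed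
      then show "(\<integral>x. (cmod (?g m x - ?g n x))\<^sup>2 \<partial>\<mu>) \<le> (e / 2)\<^sup>2"
        using N[OF order_refl \<mu>] by simp
    qed (use \<open>e > 0\<close> in simp)
    with \<open>e > 0\<close> show ?thesis by (intro exI[of _ N]) (auto intro: order_le_less_trans[of _ "e / 2"])
  qed
  ultimately show ?thesis unfolding cauchy_seqs_def by blast
qed

text \<open>Glue along the closed sets \<open>closure V\<close> and \<open>- V\<close>: they meet in
  the frontier, where the factor \<open>1 - \<phi> x\<close> vanishes and both formulas
  agree.\<close>

lemma continuous_on_open_patch:
  fixes f :: "'a::topological_space \<Rightarrow> real"
  assumes "open V" "continuous_on UNIV \<phi>" "\<And>x. x \<in> frontier V \<Longrightarrow> \<phi> x = 1" "continuous_on (- V) f"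
  shows "continuous_on UNIV (\<lambda>x. (1 - \<phi> x) * (if x \<in> V then c else f x))"
proof -
  have "continuous_on (closure V \<union> - V) (\<lambda>x. if x \<in> V then (1 - \<phi> x) * c else (1 - \<phi> x) * f x)"
  proof (rule continuous_on_cases)
    show "continuous_on (closure V) (\<lambda>x. (1 - \<phi> x) * c)" "continuous_on (- V) (\<lambda>x. (1 - \<phi> x) * f x)"
      using assms(4) continuous_on_subset[OF assms(2)] by (auto intro!: continuous_intros)
    show "\<forall>x. x \<in> closure V \<and> x \<notin> V \<or> x \<in> - V \<and> x \<in> V \<longrightarrow> (1 - \<phi> x) * c = (1 - \<phi> x) * f x"
      using assms by (auto simp: frontier_def interior_open)
  qed (use assms in auto)
  moreover have "closure V \<union> - V = UNIV" using closure_subset by auto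
  ultimately show ?thesis by (simp add: if_distrib)
qed

text \<open>Take a finite subcover by sets with null frontier; the frontier of a finite union lies
  in the union of the frontiers.\<close>

lemma small_boundary_compact_nbhd:
  fixes K :: "'a::topological_space set"
  assumes sbp: "small_boundary_property \<Delta>" and \<Delta>: "\<And>\<mu>. \<mu> \<in> \<Delta> \<Longrightarrow> borel_prob \<mu>"
    and K: "compact K" "open U" "K \<subseteq> U"
  obtains V where "open V" "K \<subseteq> V" "V \<subseteq> U" "\<And>\<mu>. \<mu> \<in> \<Delta> \<Longrightarrow> emeasure \<mu> (frontier V) = 0"
proof -
  have "\<exists>V. open V \<and> x \<in> V \<and> V \<subseteq> U \<and> (\<forall>\<mu>\<in>\<Delta>. emeasure \<mu> (frontier V) = 0)" if "x \<in> K" for x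
    using sbp K that unfolding small_boundary_property_def by blast
  then obtain W where W: "\<And>x. x \<in> K \<Longrightarrow> open (W x)" "\<And>x. x \<in> K \<Longrightarrow> x \<in> W x"
    "\<And>x. x \<in> K \<Longrightarrow> W x \<subseteq> U" "\<And>x \<mu>. x \<in> K \<Longrightarrow> \<mu> \<in> \<Delta> \<Longrightarrow> emeasure \<mu> (frontier (W x)) = 0"
    by metis
  have "K \<subseteq> (\<Union>x\<in>K. W x)" using W(2) by blast
  then obtain D where D: "D \<subseteq> K" "finite D" "K \<subseteq> (\<Union>x\<in>D. W x)"
    using compactE_image[OF K(1), of K W] W(1) by metis
  have "emeasure \<mu> (frontier (\<Union>x\<in>D. W x)) = 0" if "\<mu> \<in> \<Delta>" for \<mu>
  proof -
    have closed_sets: "C \<in> sets \<mu>" if "closed C" for C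
      using that \<Delta>[OF \<open>\<mu> \<in> \<Delta>\<close>] by (simp add: borel_prob_def)
    have "frontier (\<Union>x\<in>D. W x) \<subseteq> (\<Union>x\<in>D. frontier (W x))"
    proof
      fix y assume y: "y \<in> frontier (\<Union>x\<in>D. W x)"
      have op: "open (W x)" if "x \<in> D" for x using that D(1) W(1) by blast
      have "(\<Union>x\<in>D. W x) \<subseteq> (\<Union>x\<in>D. closure (W x))" using closure_subset by blast
      then have "closure (\<Union>x\<in>D. W x) \<subseteq> (\<Union>x\<in>D. closure (W x))"
        using D(2) by (intro closure_minimal closed_UN) auto
      with y obtain x where "x \<in> D" "y \<in> closure (W x)" by (auto simp: frontier_def)
      moreover have "y \<notin> W x" if "x \<in> D" for x
        using y op that by (auto simp: frontier_def interior_open open_UN)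
      ultimately show "y \<in> (\<Union>x\<in>D. frontier (W x))"
        using op by (auto simp: frontier_def interior_open)
    qed
    moreover have "(\<Union>x\<in>D. frontier (W x)) \<in> null_sets \<mu>"
      using D W(4)[OF _ that] closed_sets by (intro null_sets_UN' countable_finite) (auto simp: null_sets_def)
    ultimately show ?thesis
      using closed_sets null_sets_subset[of _ \<mu> "frontier (\<Union>x\<in>D. W x)"] by (auto simp: null_sets_def)
  qed
  moreover have "open (\<Union>x\<in>D. W x)" using W(1) D(1) by (intro open_UN) auto
  moreover have "(\<Union>x\<in>D. W x) \<subseteq> U" using W(3) D(1) by blast
  ultimately show thesis using that[of "\<Union>x\<in>D. W x"] D(3) by simp
qed

lemma small_boundary_imp_invertible_approx:
  fixes \<Delta> :: "'a::metric_space measure set" and f :: "'a \<Rightarrow> real"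
  assumes compact: "compact (UNIV :: 'a set)" and \<omega>: "free_ultrafilter \<omega>"
    and \<Delta>: "\<And>\<mu>. \<mu> \<in> \<Delta> \<Longrightarrow> borel_prob \<mu>" "weakstar_closed \<Delta>"
    and sbp: "small_boundary_property \<Delta>"
    and f: "continuous_on UNIV f" and "e > 0"
  shows "\<exists>g\<in>cauchy_seqs \<Delta>. selfadj_cls \<omega> \<Delta> g \<and> invertible_cls \<omega> \<Delta> g \<and>
    qnorm \<omega> \<Delta> (\<lambda>n x. complex_of_real (f x) - g n x) < e"
proof -
  \<comment> \<open>The final error is \<open>2 * c = e / 2\<close>, strictly below
    \<open>e\<close>.\<close>
  define c where "c = e / 4"
  have "c > 0" using \<open>e > 0\<close> by (simp add: c_def)
  have zero: "compact (f -` {0})" "open {x. \<bar>f x\<bar> < c}" "f -` {0} \<subseteq> {x. \<bar>f x\<bar> < c}"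
    using f closed_vimage[of "{0}" f] compact_Int_closed[OF compact, of "f -` {0}"] \<open>c > 0\<close>
    by (auto intro!: open_Collect_less continuous_intros)
  obtain V where V: "open V" "f -` {0} \<subseteq> V" "V \<subseteq> {x. \<bar>f x\<bar> < c}"
      "\<And>\<mu>. \<mu> \<in> \<Delta> \<Longrightarrow> emeasure \<mu> (frontier V) = 0"
    using small_boundary_compact_nbhd[OF sbp \<Delta>(1) zero] by blast
  have "closed (frontier V)" by simp
  from null_closed_bump[OF compact \<omega> \<Delta> this V(4)]
  obtain \<phi> where \<phi>: "uniformly_vanishing \<Delta> \<phi>" "\<And>n x. x \<in> frontier V \<Longrightarrow> \<phi> n x = 1"
    by metis
  have \<phi>': "continuous_on UNIV (\<phi> n)" "0 \<le> \<phi> n x" "\<phi> n x \<le> 1" for n x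
    using \<phi>(1) by (auto simp: uniformly_vanishing_def)
  obtain B where B: "B > 0" "\<And>x. \<bar>f x\<bar> \<le> B"
    using compact_UNIV_continuous_bounded[OF compact f] by blast
  define F where "F x = (if x \<in> V then c else f x)" for x
  have F_bound: "\<bar>F x\<bar> \<le> B + c" for x
    using B(1) B(2)[of x] \<open>c > 0\<close> by (auto simp: F_def)
  have f_V: "continuous_on (- V) f" using f by (rule continuous_on_subset) simp
  \<comment> \<open>On \<open>V\<close> the value is \<open>c\<close>; off \<open>V\<close> the
    compact set \<open>- V\<close> misses the zeros of \<open>f\<close>, so
    \<open>\<bar>f\<bar>\<close> has a positive minimum there.\<close>
  obtain d where d: "d > 0" "\<And>x. d \<le> \<bar>F x\<bar>"
  proof (cases "- V = {}")
    case True
    then show thesis using \<open>c > 0\<close> by (intro that[of c]) (auto simp: F_def)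
  next
    case False
    have "compact (- V)" using compact_diff[OF compact V(1)] by (simp add: Compl_eq_Diff_UNIV)
    moreover have "continuous_on (- V) (\<lambda>x. \<bar>f x\<bar>)"
      using f_V by (intro continuous_intros)
    ultimately obtain y where y: "y \<in> - V" "\<And>x. x \<in> - V \<Longrightarrow> \<bar>f y\<bar> \<le> \<bar>f x\<bar>"
      using continuous_attains_inf[of "- V"] False by blast
    have "\<bar>f y\<bar> > 0" using y(1) V(2) by auto
    then show thesis using \<open>c > 0\<close> y by (intro that[of "min c \<bar>f y\<bar>"]) (auto simp: F_def min_le_iff_disj)
  qed
  then have F_nz: "F x \<noteq> 0" for x by (metis abs_zero not_le)
  have F_cont: "continuous_on UNIV (\<lambda>x. (1 - \<phi> n x) * F x)" for n
    unfolding F_def using V(1) \<phi>'(1) \<phi>(2) f_V by (rule continuous_on_open_patch)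
  have inv_F: "1 / F x = (if x \<in> V then 1 / c else 1 / f x)" for x by (simp add: F_def)
  have "continuous_on (- V) (\<lambda>x. 1 / f x)"
    using f_V V(2) by (intro continuous_intros) auto
  with V(1) \<phi>'(1) \<phi>(2) have invF_cont: "continuous_on UNIV (\<lambda>x. (1 - \<phi> n x) * (1 / F x))" for n
    unfolding inv_F by (rule continuous_on_open_patch)
  define g where "g n x = complex_of_real ((1 - \<phi> n x) * F x)" for n x
  define h where "h n x = complex_of_real ((1 - \<phi> n x) * (1 / F x))" for n x
  have g: "g \<in> cauchy_seqs \<Delta>"
    unfolding g_def using \<Delta>(1) \<phi>(1) F_cont F_bound by (rule uniformly_vanishing_imp_cauchy_seqs)
  have "\<bar>1 / F x\<bar> \<le> 1 / d" for x
    using d(1) d(2)[of x] F_nz[of x] by (simp add: frac_le)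
  with \<Delta>(1) \<phi>(1) invF_cont have h: "h \<in> cauchy_seqs \<Delta>"
    unfolding h_def by (rule uniformly_vanishing_imp_cauchy_seqs)
  have "selfadj_cls \<omega> \<Delta> g"
    unfolding selfadj_cls_def
    \<comment> \<open>The constant 0 works because \<open>g\<close> is real valued.\<close>
    by (rule uniformly_vanishing_imp_J2[OF \<omega> \<Delta>(1) \<phi>(1), of _ 0]) (simp_all add: g_def)
  moreover have "(\<lambda>n x. g n x * h n x - 1) \<in> J2 \<omega> \<Delta>"
  proof (rule uniformly_vanishing_imp_J2[OF \<omega> \<Delta>(1) \<phi>(1), of _ 2])
    fix n
    show "continuous_on UNIV (\<lambda>x. g n x * h n x - 1)"
      using g h by (auto simp: cauchy_seqs_def linf_seq_def intro!: continuous_intros)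
    fix x
    have "g n x * h n x - 1 = of_real ((1 - \<phi> n x)\<^sup>2 - 1)"
      using F_nz[of x] by (simp add: g_def h_def power2_eq_square)
    moreover have "(1 - \<phi> n x)\<^sup>2 - 1 = - \<phi> n x * (2 - \<phi> n x)"
      by (simp add: power2_eq_square algebra_simps)
    ultimately have "cmod (g n x * h n x - 1) = \<phi> n x * (2 - \<phi> n x)"
      using \<phi>'(2,3)[of n x] by (simp add: abs_mult del: of_real_mult)
    also have "\<dots> \<le> \<phi> n x * 2" using \<phi>'(2)[of n x] by (intro mult_left_mono) auto
    finally show "cmod (g n x * h n x - 1) \<le> 2 * \<phi> n x" by simp
  qed
  with h have "invertible_cls \<omega> \<Delta> g" unfolding invertible_cls_def by blast
  moreover have "qnorm \<omega> \<Delta> (\<lambda>n x. complex_of_real (f x) - g n x) \<le> 2 * c"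
  proof (rule qnorm_le)
    show "linf_seq (\<lambda>n x. complex_of_real (f x) - g n x)"
      using linf_seq_add[OF linf_seq_const[OF compact] linf_seq_mult[OF linf_seq_const[OF compact]],
        of "\<lambda>x. of_real (f x)" "\<lambda>_. -1" g] f g
      by (simp add: cauchy_seqs_def continuous_on_of_real)
    \<comment> \<open>This correction turns \<open>f - g n\<close> into
      \<open>(1 - \<phi> n) * (f - F)\<close>, which is zero off \<open>V\<close> and at most
      \<open>2 * c\<close> on \<open>V\<close>.\<close>
    show "(\<lambda>n x. complex_of_real (- (\<phi> n x * f x))) \<in> J2 \<omega> \<Delta>"
    proof (rule uniformly_vanishing_imp_J2[OF \<omega> \<Delta>(1) \<phi>(1), of _ B])
      show "continuous_on UNIV (\<lambda>x. complex_of_real (- (\<phi> n x * f x)))" for n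
        using f \<phi>' by (intro continuous_intros)
      show "cmod (complex_of_real (- (\<phi> n x * f x))) \<le> B * \<phi> n x" for n x
        using B(2)[of x] \<phi>'(2)[of n x] by (simp add: norm_mult mult.commute[of B]
            mult.commute[of _ "complex_of_real (\<phi> n x)"] mult_left_mono)
    qed
    fix n x
    have "complex_of_real (f x) - g n x + complex_of_real (- (\<phi> n x * f x))
        = of_real ((1 - \<phi> n x) * (f x - F x))"
      by (simp add: g_def algebra_simps)
    moreover have "\<bar>(1 - \<phi> n x) * (f x - F x)\<bar> \<le> 1 * (2 * c)"
      unfolding abs_mult using \<phi>'(2,3)[of n x] V(3) \<open>c > 0\<close>
      by (intro mult_mono) (auto simp: F_def)
    ultimately show "cmod (complex_of_real (f x) - g n x + complex_of_real (- (\<phi> n x * f x))) \<le> 2 * c"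
      by (simp del: of_real_mult of_real_diff)
  qed
  then have "qnorm \<omega> \<Delta> (\<lambda>n x. complex_of_real (f x) - g n x) < e"
    using \<open>e > 0\<close> by (simp add: c_def)
  ultimately show ?thesis using g by blast
qed

section \<open>Small boundaries from approximation\<close>

text \<open>Chebyshev's inequality, uniformly over \<open>\<Delta>\<close>.\<close>

lemma measure_cmod_ge_le:
  fixes f :: "'a::topological_space \<Rightarrow> complex"
  assumes \<Delta>: "\<And>\<mu>. \<mu> \<in> \<Delta> \<Longrightarrow> borel_prob \<mu>" and f: "continuous_on UNIV f" "\<And>x. cmod (f x) \<le> B"
    and "c > 0" "\<mu> \<in> \<Delta>" and small: "sup_tr2 \<Delta> f < c\<^sup>2 * e"
  shows "measure \<mu> {x. c \<le> cmod (f x)} \<le> e"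
proof -
  have b: "borel_prob \<mu>" using assms by blast
  interpret prob_space \<mu> using b by (simp add: borel_prob_def)
  have "(\<lambda>x. cmod (f x)) \<in> borel_measurable \<mu>"
    using f by (intro borel_prob_measurable[OF b] borel_measurable_continuous_onI continuous_intros)
  moreover have "integrable \<mu> (\<lambda>x. (cmod (f x))\<^sup>2)"
    using b f by (rule continuous_integrable_cmod_power2)
  ultimately have "measure \<mu> {x. c \<le> cmod (f x)} \<le> (\<integral>x. (cmod (f x))\<^sup>2 \<partial>\<mu>) / c\<^sup>2"
    using second_moment_method[of "\<lambda>x. cmod (f x)" c] \<open>c > 0\<close> b by simp
  also have "\<dots> \<le> sup_tr2 \<Delta> f / c\<^sup>2"
    using sup_tr2_bounded(3)[OF \<Delta> f \<open>\<mu> \<in> \<Delta>\<close>] by (intro divide_right_mono) auto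
  also have "\<dots> \<le> e"
    using small \<open>c > 0\<close> by (simp add: divide_le_eq mult.commute less_imp_le)
  finally show ?thesis .
qed

lemma J2_eventually_small:
  assumes "a \<in> J2 \<omega> \<Delta>" "e > 0"
  shows "\<forall>\<^sub>F n in \<omega>. sup_tr2 \<Delta> (a n) < e"
  using assms unfolding J2_def by (auto intro: order_tendstoD)

lemma linf_seqE:
  assumes "linf_seq a"
  obtains B where "B > 0" "\<And>n. continuous_on UNIV (a n)" "\<And>n x. cmod (a n x) \<le> B"
proof -
  obtain B where "\<And>n. continuous_on UNIV (a n)" "\<And>n x. cmod (a n x) \<le> B"
    using assms unfolding linf_seq_def by blast
  then show thesis by (intro that[of "max B 1"]) (auto simp: le_max_iff_disj)
qed

text \<open>Truncating \<open>Re (g n)\<close> to the band of width \<open>e\<close> around \<open>f\<close> turns closeness in the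
  trace norm into uniform closeness, changing \<open>g n\<close> only on a set of small measure.\<close>
lemma invertible_approx_imp_small_zero_nbhd:
  fixes \<Delta> :: "'a::topological_space measure set" and f :: "'a \<Rightarrow> real"
  assumes compact: "compact (UNIV :: 'a set)" and \<omega>: "free_ultrafilter \<omega>"
    and \<Delta>: "\<And>\<mu>. \<mu> \<in> \<Delta> \<Longrightarrow> borel_prob \<mu>"
    and f: "continuous_on UNIV f" and "e > 0" "\<eta> > 0"
    and approx: "\<And>\<epsilon>. \<epsilon> > 0 \<Longrightarrow> \<exists>g\<in>cauchy_seqs \<Delta>. selfadj_cls \<omega> \<Delta> g \<and> invertible_cls \<omega> \<Delta> g \<and>
      norm2w \<omega> \<Delta> (\<lambda>n x. complex_of_real (f x) - g n x) < \<epsilon>"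
  shows "\<exists>h r. continuous_on UNIV h \<and> (\<forall>x. \<bar>h x - f x\<bar> \<le> e) \<and> r > 0 \<and>
    (\<forall>\<mu>\<in>\<Delta>. measure \<mu> {x. \<bar>h x\<bar> < r} \<le> \<eta>)"
proof -
  \<comment> \<open>The Chebyshev threshold for level \<open>e\<close>: three exceptional sets will
    share the budget \<open>\<eta>\<close>.\<close>
  have "e\<^sup>2 * (\<eta> / 3) > 0" using \<open>e > 0\<close> \<open>\<eta> > 0\<close> by simp
  from approx[OF this] obtain g where g: "g \<in> cauchy_seqs \<Delta>" "selfadj_cls \<omega> \<Delta> g" "invertible_cls \<omega> \<Delta> g"
    and near: "norm2w \<omega> \<Delta> (\<lambda>n x. complex_of_real (f x) - g n x) < e\<^sup>2 * (\<eta> / 3)"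
    by blast
  obtain k where k: "k \<in> cauchy_seqs \<Delta>" and inv: "(\<lambda>n x. g n x * k n x - 1) \<in> J2 \<omega> \<Delta>"
    using g(3) unfolding invertible_cls_def by blast
  have linf: "linf_seq g" "linf_seq k" using g(1) k by (auto simp: cauchy_seqs_def)
  obtain B where B: "B > 0" "\<And>n x. cmod (k n x) \<le> B" by (rule linf_seqE[OF linf(2)]) blast
  have g_cont: "continuous_on UNIV (g n)" for n using linf(1) by (simp add: linf_seq_def)
  \<comment> \<open>With \<open>B\<close> bounding the inverse \<open>k\<close>, a value of
    \<open>g\<close> below \<open>\<delta>\<close> in modulus keeps the product with
    \<open>k\<close> within \<open>1 / 2\<close> of 0, hence at least \<open>1 / 2\<close> away from
    1.\<close>
  define \<delta> where "\<delta> = 1 / (2 * B)"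
  have "\<delta> > 0" using B(1) by (simp add: \<delta>_def)
  have linf_diff: "linf_seq (\<lambda>n x. complex_of_real (f x) - g n x)"
    using linf_seq_add[OF linf_seq_const[OF compact] linf_seq_mult[OF linf_seq_const[OF compact] linf(1)],
      of "\<lambda>x. of_real (f x)" "\<lambda>_. -1"] f
    by (simp add: continuous_on_of_real)
  have "\<forall>\<^sub>F n in \<omega>. sup_tr2 \<Delta> (\<lambda>x. complex_of_real (f x) - g n x) < e\<^sup>2 * (\<eta> / 3)"
    using \<omega> \<Delta> linf_diff near by (rule norm2w_less_imp_eventually)
  moreover have "\<forall>\<^sub>F n in \<omega>. sup_tr2 \<Delta> (\<lambda>x. cnj (g n x) - g n x) < \<delta>\<^sup>2 * (\<eta> / 3)"
    using \<open>\<eta> > 0\<close> \<open>\<delta> > 0\<close> g(2) unfolding selfadj_cls_def by (intro J2_eventually_small) auto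
  moreover have "\<forall>\<^sub>F n in \<omega>. sup_tr2 \<Delta> (\<lambda>x. g n x * k n x - 1) < (1 / 2)\<^sup>2 * (\<eta> / 3)"
    using \<open>\<eta> > 0\<close> inv by (intro J2_eventually_small) auto
  ultimately have "\<forall>\<^sub>F n in \<omega>. sup_tr2 \<Delta> (\<lambda>x. complex_of_real (f x) - g n x) < e\<^sup>2 * (\<eta> / 3) \<and>
      sup_tr2 \<Delta> (\<lambda>x. cnj (g n x) - g n x) < \<delta>\<^sup>2 * (\<eta> / 3) \<and>
      sup_tr2 \<Delta> (\<lambda>x. g n x * k n x - 1) < (1 / 2)\<^sup>2 * (\<eta> / 3)"
    by (intro eventually_conj)
  moreover have "\<omega> \<noteq> bot" using \<omega> by (simp add: free_ultrafilter_def)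
  ultimately obtain n where n: "sup_tr2 \<Delta> (\<lambda>x. complex_of_real (f x) - g n x) < e\<^sup>2 * (\<eta> / 3)"
      "sup_tr2 \<Delta> (\<lambda>x. cnj (g n x) - g n x) < \<delta>\<^sup>2 * (\<eta> / 3)"
      "sup_tr2 \<Delta> (\<lambda>x. g n x * k n x - 1) < (1 / 2)\<^sup>2 * (\<eta> / 3)"
    using eventually_happens' by blast
  define h where "h x = max (f x - e) (min (f x + e) (Re (g n x)))" for x
  have h_cont: "continuous_on UNIV h"
    unfolding h_def using f g_cont by (intro continuous_intros)
  define S1 where "S1 = {x. e \<le> cmod (complex_of_real (f x) - g n x)}"
  define S2 where "S2 = {x. \<delta> \<le> cmod (cnj (g n x) - g n x)}"
  define S3 where "S3 = {x. 1 / 2 \<le> cmod (g n x * k n x - 1)}"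
  \<comment> \<open>Off \<open>S1\<close> the truncation is inactive, so \<open>h\<close> is the
    real part of \<open>g n\<close>; off \<open>S2\<close> the imaginary part is below
    \<open>\<delta> / 2\<close>. A small \<open>h\<close> then forces \<open>g n\<close> below
    \<open>\<delta>\<close>, which is impossible off \<open>S3\<close>.\<close>
  have sub: "{x. \<bar>h x\<bar> < \<delta> / 2} \<subseteq> S1 \<union> S2 \<union> S3"
  proof
    fix x assume "x \<in> {x. \<bar>h x\<bar> < \<delta> / 2}"
    then have hx: "\<bar>h x\<bar> < \<delta> / 2" by simp
    show "x \<in> S1 \<union> S2 \<union> S3"
    proof (rule ccontr)
      assume "x \<notin> S1 \<union> S2 \<union> S3"
      then have x: "cmod (complex_of_real (f x) - g n x) < e" "cmod (cnj (g n x) - g n x) < \<delta>"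
          "cmod (g n x * k n x - 1) < 1 / 2"
        by (auto simp: S1_def S2_def S3_def)
      have "\<bar>f x - Re (g n x)\<bar> < e"
        using x(1) abs_Re_le_cmod[of "complex_of_real (f x) - g n x"] by simp
      then have "h x = Re (g n x)" by (auto simp: h_def)
      moreover have "\<bar>Im (g n x)\<bar> < \<delta> / 2"
        using x(2) abs_Im_le_cmod[of "cnj (g n x) - g n x"] by simp
      ultimately have "cmod (g n x) < \<delta>"
        using hx cmod_le[of "g n x"] by linarith
      then have "cmod (g n x * k n x) \<le> \<delta> * B"
        unfolding norm_mult using B(2)[of n x] by (intro mult_mono) (use \<open>\<delta> > 0\<close> in auto)
      then have "cmod (g n x * k n x) \<le> 1 / 2" using B(1) by (simp add: \<delta>_def)
      then have "1 / 2 \<le> cmod (g n x * k n x - 1)"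
        using norm_triangle_ineq2[of 1 "g n x * k n x"] by (simp add: norm_minus_commute)
      with x(3) show False by simp
    qed
  qed
  show ?thesis
  proof (intro exI[of _ h] exI[of _ "\<delta> / 2"] conjI allI ballI)
    show "\<bar>h x - f x\<bar> \<le> e" for x using \<open>e > 0\<close> by (auto simp: h_def)
    fix \<mu> assume \<mu>: "\<mu> \<in> \<Delta>"
    show "measure \<mu> {x. \<bar>h x\<bar> < \<delta> / 2} \<le> \<eta>"
    proof -
      have b: "borel_prob \<mu>" using \<Delta> \<mu> .
      interpret prob_space \<mu> using b by (simp add: borel_prob_def)
      have cont: "continuous_on UNIV (\<lambda>x. complex_of_real (f x) - g n x)"
        "continuous_on UNIV (\<lambda>x. cnj (g n x) - g n x)" "continuous_on UNIV (\<lambda>x. g n x * k n x - 1)"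
        using f g_cont linf(2) by (auto simp: linf_seq_def intro!: continuous_intros)
      have bd: "\<exists>C. \<forall>x. cmod (F x) \<le> C" if "continuous_on UNIV F" for F :: "'a \<Rightarrow> complex"
        using linf_seq_const[OF compact that] by (auto simp: linf_seq_def)
      have S1: "measure \<mu> S1 \<le> \<eta> / 3"
        using bd[OF cont(1)] measure_cmod_ge_le[OF \<Delta> cont(1) _ \<open>e > 0\<close> \<mu> n(1)] unfolding S1_def by blast
      have S2: "measure \<mu> S2 \<le> \<eta> / 3"
        using bd[OF cont(2)] measure_cmod_ge_le[OF \<Delta> cont(2) _ \<open>\<delta> > 0\<close> \<mu> n(2)] unfolding S2_def by blast
      have S3: "measure \<mu> S3 \<le> \<eta> / 3"
        using bd[OF cont(3)] measure_cmod_ge_le[OF \<Delta> cont(3) _ _ \<mu> n(3)] unfolding S3_def by force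
      have "closed S1" "closed S2" "closed S3"
        unfolding S1_def S2_def S3_def using cont by (auto intro!: closed_Collect_le continuous_intros)
      then have sets: "S1 \<in> sets \<mu>" "S2 \<in> sets \<mu>" "S3 \<in> sets \<mu>"
        using b by (auto simp: borel_prob_def)
      have "measure \<mu> {x. \<bar>h x\<bar> < \<delta> / 2} \<le> measure \<mu> (S1 \<union> S2 \<union> S3)"
        using sub sets by (intro finite_measure_mono) auto
      also have "\<dots> \<le> measure \<mu> (S1 \<union> S2) + measure \<mu> S3" using sets by (intro measure_Un_le) auto
      also have "measure \<mu> (S1 \<union> S2) \<le> measure \<mu> S1 + measure \<mu> S2" using sets by (intro measure_Un_le)
      finally have "measure \<mu> {x. \<bar>h x\<bar> < \<delta> / 2} \<le> measure \<mu> S1 + measure \<mu> S2 + measure \<mu> S3" by simp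
      with S1 S2 S3 show ?thesis by linarith
    qed
  qed (use h_cont \<open>\<delta> > 0\<close> in auto)
qed

text \<open>The functions \<open>h k\<close> are chosen with increments so small that a zero of the limit is a
  point where \<open>\<bar>h k\<bar> < 3 * d k\<close> for every \<open>k\<close>.\<close>
lemma null_zero_set_approx:
  fixes \<Delta> :: "'a::topological_space measure set" and f :: "'a \<Rightarrow> real"
  assumes \<Delta>: "\<And>\<mu>. \<mu> \<in> \<Delta> \<Longrightarrow> borel_prob \<mu>"
    and dense: "\<And>(f :: 'a \<Rightarrow> real) e \<eta>. continuous_on UNIV f \<Longrightarrow> e > 0 \<Longrightarrow> \<eta> > 0 \<Longrightarrow>
      \<exists>h r. continuous_on UNIV h \<and> (\<forall>x. \<bar>h x - f x\<bar> \<le> e) \<and> r > 0 \<and>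
        (\<forall>\<mu>\<in>\<Delta>. measure \<mu> {x. \<bar>h x\<bar> < r} \<le> \<eta>)"
    and f: "continuous_on UNIV f" and "e > 0"
  shows "\<exists>h. continuous_on UNIV h \<and> (\<forall>x. \<bar>h x - f x\<bar> \<le> e) \<and>
    (\<forall>\<mu>\<in>\<Delta>. emeasure \<mu> {x. h x = 0} = 0)"
proof -
  \<comment> \<open>A state pairs the current function with the tolerance for later changes. The
    measure bound is guarded by \<open>k > 0\<close> because \<open>1 / 0\<close> is 0.\<close>
  define P where "P k s \<longleftrightarrow> continuous_on UNIV (fst s) \<and> snd s > 0 \<and> (k = 0 \<longrightarrow> s = (f, e)) \<and>
    (k > 0 \<longrightarrow> (\<forall>\<mu>\<in>\<Delta>. measure \<mu> {x. \<bar>fst s x\<bar> < 3 * snd s} \<le> 1 / real k))"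
    for k :: nat and s :: "('a \<Rightarrow> real) \<times> real"
  define Q where "Q s t \<longleftrightarrow> (\<forall>x. \<bar>fst t x - fst s x\<bar> \<le> snd s / 2) \<and> snd t \<le> snd s / 2"
    for s t :: "('a \<Rightarrow> real) \<times> real"
  have "\<exists>s. \<forall>k. P k (s k) \<and> Q (s k) (s (Suc k))"
  proof (rule dependent_nat_choice)
    show "\<exists>s. P 0 s" using f \<open>e > 0\<close> by (intro exI[of _ "(f, e)"]) (simp add: P_def)
    fix s k assume s: "P k s"
    then have "continuous_on UNIV (fst s)" "snd s / 2 > 0" by (auto simp: P_def)
    from dense[OF this, of "1 / real (Suc k)"] obtain h r where
      h: "continuous_on UNIV h" "\<forall>x. \<bar>h x - fst s x\<bar> \<le> snd s / 2" "r > 0"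
        "\<forall>\<mu>\<in>\<Delta>. measure \<mu> {x. \<bar>h x\<bar> < r} \<le> 1 / real (Suc k)"
      by auto
    \<comment> \<open>Halving makes the tolerances summable; \<open>r / 3\<close> puts the level set
      for \<open>3 * ?d\<close> inside the one for \<open>r\<close>.\<close>
    let ?d = "min (snd s / 2) (r / 3)"
    have "measure \<mu> {x. \<bar>h x\<bar> < 3 * ?d} \<le> 1 / real (Suc k)" if "\<mu> \<in> \<Delta>" for \<mu>
    proof -
      have b: "borel_prob \<mu>" using \<Delta> that .
      interpret prob_space \<mu> using b by (simp add: borel_prob_def)
      have "open {x. \<bar>h x\<bar> < r}" using h(1) by (intro open_Collect_less continuous_intros)
      then have "measure \<mu> {x. \<bar>h x\<bar> < 3 * ?d} \<le> measure \<mu> {x. \<bar>h x\<bar> < r}"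
        using b by (intro finite_measure_mono) (auto simp: borel_prob_def)
      then show ?thesis using h(4) that by force
    qed
    then have "P (Suc k) (h, ?d) \<and> Q s (h, ?d)"
      using h \<open>snd s / 2 > 0\<close> by (simp add: P_def Q_def)
    then show "\<exists>t. P (Suc k) t \<and> Q s t" by blast
  qed
  then obtain s where s: "\<And>k. P k (s k)" "\<And>k. Q (s k) (s (Suc k))" by blast
  define h where "h k = fst (s k)" for k
  define d where "d k = snd (s k)" for k
  have h_cont: "continuous_on UNIV (h k)" and d_pos: "d k > 0" for k
    using s(1)[of k] by (auto simp: P_def h_def d_def)
  have init: "h 0 = f" "d 0 = e" using s(1)[of 0] by (auto simp: P_def h_def d_def)
  have small: "measure \<mu> {x. \<bar>h k x\<bar> < 3 * d k} \<le> 1 / real k" if "k > 0" "\<mu> \<in> \<Delta>" for k \<mu>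
    using s(1)[of k] that by (auto simp: P_def h_def d_def)
  have step: "\<bar>h (Suc k) x - h k x\<bar> \<le> d k / 2" "d (Suc k) \<le> d k / 2" for k x
    using s(2)[of k] by (auto simp: Q_def h_def d_def)
  \<comment> \<open>The bound \<open>d k - d m\<close> telescopes: a step moves by at most
    \<open>d m / 2\<close>, which is at most \<open>d m - d (Suc m)\<close>.\<close>
  have tail: "\<bar>h m x - h k x\<bar> \<le> d k - d m" if "k \<le> m" for k m x
    using that
  proof (induction m rule: dec_induct)
    case (step m)
    then show ?case using \<open>\<bar>h (Suc m) x - h m x\<bar> \<le> d m / 2\<close> \<open>d (Suc m) \<le> d m / 2\<close> by linarith
  qed simp
  then have tail': "\<bar>h m x - h k x\<bar> \<le> d k" if "k \<le> m" for k m x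
    using tail[OF that, of x] d_pos[of m] by linarith
  have d_le: "d k \<le> e * (1 / 2) ^ k" for k
  proof (induction k)
    case (Suc k)
    then show ?case using step(2)[of k] by simp
  qed (simp add: init)
  have "(\<lambda>k. e * (1 / 2) ^ k) \<longlonglongrightarrow> e * 0"
    by (intro tendsto_mult tendsto_const LIMSEQ_power_zero) simp
  then have d_lim: "d \<longlonglongrightarrow> 0"
    using d_pos d_le by (intro tendsto_sandwich[of "\<lambda>_. 0" d _ "\<lambda>k. e * (1 / 2) ^ k"]) (auto simp: less_imp_le)
  have "uniformly_Cauchy_on UNIV h"
  proof (rule uniformly_Cauchy_onI')
    fix \<epsilon> :: real assume "\<epsilon> > 0"
    then obtain N where "d N < \<epsilon>"
      using order_tendstoD(2)[OF d_lim] by (auto simp: eventually_sequentially)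
    have "dist (h m x) (h n x) < \<epsilon>" if "m \<ge> N" "n > m" for m n x
    proof -
      \<comment> \<open>Monotonicity of \<open>d\<close> is read off from \<open>tail\<close>, whose
        left side is nonnegative at any point whatsoever.\<close>
      have "d m \<le> d N" using tail[OF that(1), of undefined] by linarith
      moreover have "\<bar>h n x - h m x\<bar> \<le> d m" using tail'[of m n x] that by simp
      ultimately show ?thesis using \<open>d N < \<epsilon>\<close> by (simp add: dist_real_def)
    qed
    then show "\<exists>M. \<forall>x\<in>UNIV. \<forall>m\<ge>M. \<forall>n>m. dist (h m x) (h n x) < \<epsilon>" by blast
  qed
  then have "uniformly_convergent_on UNIV h" by (rule Cauchy_uniformly_convergent)
  then obtain H where H: "uniform_limit UNIV h H sequentially" unfolding uniformly_convergent_on_def by blast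
  have "continuous_on UNIV H"
    using h_cont by (intro uniform_limit_theorem[OF _ H]) auto
  moreover have H_near: "\<bar>H x - h k x\<bar> \<le> d k" for k x
  proof (rule LIMSEQ_le_const2)
    have "(\<lambda>m. h m x) \<longlonglongrightarrow> H x" using H by (rule tendsto_uniform_limitI) simp
    then show "(\<lambda>m. \<bar>h m x - h k x\<bar>) \<longlonglongrightarrow> \<bar>H x - h k x\<bar>" by (intro tendsto_intros)
  qed (use tail' in blast)
  moreover have "emeasure \<mu> {x. H x = 0} = 0" if "\<mu> \<in> \<Delta>" for \<mu>
  proof -
    have b: "borel_prob \<mu>" using \<Delta> that .
    interpret prob_space \<mu> using b by (simp add: borel_prob_def)
    have "measure \<mu> {x. H x = 0} \<le> 1 / real (Suc k)" for k
    proof -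
      have "open {x. \<bar>h (Suc k) x\<bar> < 3 * d (Suc k)}"
        using h_cont by (intro open_Collect_less continuous_intros)
      \<comment> \<open>At a zero of \<open>H\<close> the value of \<open>h (Suc k)\<close> is at
        most \<open>d (Suc k)\<close>, so the zero set lies in level sets of arbitrarily small
        measure.\<close>
      moreover have "{x. H x = 0} \<subseteq> {x. \<bar>h (Suc k) x\<bar> < 3 * d (Suc k)}"
      proof clarify
        fix x assume "H x = 0"
        then show "\<bar>h (Suc k) x\<bar> < 3 * d (Suc k)"
          using H_near[of x "Suc k"] d_pos[of "Suc k"] by linarith
      qed
      ultimately have "measure \<mu> {x. H x = 0} \<le> measure \<mu> {x. \<bar>h (Suc k) x\<bar> < 3 * d (Suc k)}"
        using b by (intro finite_measure_mono) (auto simp: borel_prob_def)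
      also have "\<dots> \<le> 1 / real (Suc k)" using small[of "Suc k"] that by blast
      finally show ?thesis .
    qed
    then have "measure \<mu> {x. H x = 0} \<le> 0"
      using LIMSEQ_inverse_real_of_nat by (intro LIMSEQ_le_const) (auto simp: inverse_eq_divide)
    then show ?thesis by (simp add: emeasure_eq_measure measure_le_0_iff)
  qed
  ultimately show ?thesis using init by metis
qed

lemma null_zero_set_approx_imp_small_boundary:
  fixes \<Delta> :: "'a::metric_space measure set"
  assumes \<Delta>: "\<And>\<mu>. \<mu> \<in> \<Delta> \<Longrightarrow> borel_prob \<mu>"
    and approx: "\<And>(f :: 'a \<Rightarrow> real) e. continuous_on UNIV f \<Longrightarrow> e > 0 \<Longrightarrow>
      \<exists>h. continuous_on UNIV h \<and> (\<forall>x. \<bar>h x - f x\<bar> \<le> e) \<and> (\<forall>\<mu>\<in>\<Delta>. emeasure \<mu> {x. h x = 0} = 0)"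
  shows "small_boundary_property \<Delta>"
  unfolding small_boundary_property_def
proof (intro allI impI, elim conjE)
  fix x :: 'a and U assume U: "open U" "x \<in> U"
  obtain e where e: "e > 0" "\<And>y. dist y x < e \<Longrightarrow> y \<in> U"
    using U unfolding open_dist by blast
  \<comment> \<open>This function is 1 at \<open>x\<close> and at most -1 outside the ball of radius
    \<open>e\<close>, so an error of \<open>1 / 2\<close> leaves both signs intact.\<close>
  have "continuous_on UNIV (\<lambda>y. 1 - 2 * dist y x / e)"
    using e(1) by (intro continuous_intros) auto
  from approx[OF this, of "1 / 2"]
  obtain h where h: "continuous_on UNIV h" "\<And>y. \<bar>h y - (1 - 2 * dist y x / e)\<bar> \<le> 1 / 2"
      "\<And>\<mu>. \<mu> \<in> \<Delta> \<Longrightarrow> emeasure \<mu> {x. h x = 0} = 0"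
    by auto
  let ?V = "{y. 0 < h y}"
  have open_V: "open ?V" using h(1) by (intro open_Collect_less continuous_intros)
  have "x \<in> ?V" using h(2)[of x] abs_ge_minus_self[of "h x - 1"] by simp
  moreover have "?V \<subseteq> U"
  proof clarify
    fix y assume "0 < h y"
    then have "2 * dist y x / e < 2" using h(2)[of y] by linarith
    then show "y \<in> U" using e by (simp add: divide_less_eq)
  qed
  moreover have "emeasure \<mu> (frontier ?V) = 0" if "\<mu> \<in> \<Delta>" for \<mu>
  proof -
    have closed: "closed {y. 0 \<le> h y}" "closed {y. h y = 0}"
      using h(1) by (auto intro!: closed_Collect_le closed_Collect_eq continuous_intros)
    \<comment> \<open>Since \<open>?V\<close> is open, its frontier is its closure without the
      points where \<open>h\<close> is positive, leaving only zeros of \<open>h\<close>.\<close>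
    have "closure ?V \<subseteq> {y. 0 \<le> h y}" using closed(1) by (intro closure_minimal) auto
    then have "frontier ?V \<subseteq> {y. h y = 0}"
      using open_V by (auto simp: frontier_def interior_open)
    then have "emeasure \<mu> (frontier ?V) \<le> emeasure \<mu> {y. h y = 0}"
      using closed(2) \<Delta>[OF that] by (intro emeasure_mono) (auto simp: borel_prob_def)
    then show ?thesis using h(3)[OF that] by simp
  qed
  ultimately show "\<exists>V. open V \<and> x \<in> V \<and> V \<subseteq> U \<and> (\<forall>\<mu>\<in>\<Delta>. emeasure \<mu> (frontier V) = 0)"
    using open_V by blast
qed

theorem theorem2p16:
  fixes \<omega> :: "nat filter" and \<Delta> :: "'a::metric_space measure set"
  assumes "compact (UNIV :: 'a set)"
    and "free_ultrafilter \<omega>"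
    and "\<forall>\<mu>\<in>\<Delta>. borel_prob \<mu>"
    and "weakstar_closed \<Delta>"
  shows "(small_boundary_property \<Delta> \<longrightarrow>
           (\<forall>f :: 'a \<Rightarrow> real. continuous_on UNIV f \<longrightarrow>
             (\<forall>\<epsilon>>0. \<exists>g\<in>cauchy_seqs \<Delta>. selfadj_cls \<omega> \<Delta> g \<and> invertible_cls \<omega> \<Delta> g \<and>
                 qnorm \<omega> \<Delta> (\<lambda>n x. complex_of_real (f x) - g n x) < \<epsilon>)))
       \<and> ((\<forall>f :: 'a \<Rightarrow> real. continuous_on UNIV f \<longrightarrow>
             (\<forall>\<epsilon>>0. \<exists>g\<in>cauchy_seqs \<Delta>. selfadj_cls \<omega> \<Delta> g \<and> invertible_cls \<omega> \<Delta> g \<and>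
                 norm2w \<omega> \<Delta> (\<lambda>n x. complex_of_real (f x) - g n x) < \<epsilon>))
           \<longrightarrow> small_boundary_property \<Delta>)"
proof (intro conjI impI allI)
  have \<Delta>: "\<And>\<mu>. \<mu> \<in> \<Delta> \<Longrightarrow> borel_prob \<mu>" using assms(3) by blast
  show "\<exists>g\<in>cauchy_seqs \<Delta>. selfadj_cls \<omega> \<Delta> g \<and> invertible_cls \<omega> \<Delta> g \<and>
      qnorm \<omega> \<Delta> (\<lambda>n x. complex_of_real (f x) - g n x) < \<epsilon>"
    if "small_boundary_property \<Delta>" "continuous_on UNIV f" "\<epsilon> > 0" for f :: "'a \<Rightarrow> real" and \<epsilon>
    using assms(1,2) \<Delta> assms(4) that by (rule small_boundary_imp_invertible_approx)
  assume *: "\<forall>f :: 'a \<Rightarrow> real. continuous_on UNIV f \<longrightarrow>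
    (\<forall>\<epsilon>>0. \<exists>g\<in>cauchy_seqs \<Delta>. selfadj_cls \<omega> \<Delta> g \<and> invertible_cls \<omega> \<Delta> g \<and>
      norm2w \<omega> \<Delta> (\<lambda>n x. complex_of_real (f x) - g n x) < \<epsilon>)"
  \<comment> \<open>The hypothesis covers every continuous function, so the approximation can be
    repeated starting from each approximant.\<close>
  have dense: "\<exists>h r. continuous_on UNIV h \<and> (\<forall>x. \<bar>h x - f x\<bar> \<le> e) \<and> r > 0 \<and>
      (\<forall>\<mu>\<in>\<Delta>. measure \<mu> {x. \<bar>h x\<bar> < r} \<le> \<eta>)"
    if f: "continuous_on UNIV f" and pos: "e > 0" "\<eta> > 0" for f :: "'a \<Rightarrow> real" and e \<eta>
    using assms(1,2) \<Delta> f pos *[rule_format, OF f] by (rule invertible_approx_imp_small_zero_nbhd)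
  show "small_boundary_property \<Delta>"
    using \<Delta>
  proof (rule null_zero_set_approx_imp_small_boundary)
    show "\<exists>h. continuous_on UNIV h \<and> (\<forall>x. \<bar>h x - f x\<bar> \<le> e) \<and> (\<forall>\<mu>\<in>\<Delta>. emeasure \<mu> {x. h x = 0} = 0)"
      if "continuous_on UNIV f" "e > 0" for f :: "'a \<Rightarrow> real" and e
      using \<Delta> dense that by (rule null_zero_set_approx)
  qed
qed

end
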